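(* Let $n\ge3$, $d\ge2$, $p\ge1$ be integers and $\gamma\in\Gamma$ with $d=d(\gamma)\le p$, and suppose that conditions $\mathbf H_1$, $\mathbf H_2$ and $\mathbf H_3$ (stated in the context) hold. Then $$\sup_{Q\in\mathcal Q_n}\ \sup_{\|S\|\le r}\Big(\mathcal R_Q(S^*_\gamma,S)-\mathcal R_Q(\hat S_\gamma,S)\Big)\le -c_n^2 ,$$ where the inner supremum is over Lipschitz $1$-periodic functions $S$ with $\|S\|\le r$, and $c_n=\dfrac{l_*}{n\,(r+\sqrt{\bar d\,\varkappa^*})}$ with $\bar d=d/n$.
   Context: Model. $n,p\ge1$ are integers and $t_j=j/p$. The process $(y_t)_{0\le t\le n}$ obeys $dy_t=S(t)\,dt+d\xi_t$, where $S:\mathbb R\to\mathbb R$ is an unknown $1$-periodic function in $L_2[0,1]$ and $(\xi_t)$ is a square integrable semimartingale with paths in the Skorokhod space $D[0,n]$ whose unknown distribution $Q$ belongs to a family $\mathcal Q_n$; only $(y_{t_j})_{0\le j\le np}$ is observed. For each $Q$ there is a constant $\varkappa_Q>0$ such that, for every $f\in L_2[0,n]$, $I_n(f)=\int_0^nf(s)\,d\xi_s$ satisfies $E_QI_n(f)=0$ and $E_QI_n^2(f)\le\varkappa_Q\int_0^nf^2(s)\,ds$. $E_{Q,S}$ is expectation under the law of $y$. $\|f\|^2=\int_0^1f^2(t)\,dt$, $(f,g)$ is the inner product of $L_2[0,1]$, and $|x|_d^2=\sum_{j=1}^dx_j^2$. The quadratic risk is $\mathcal R_Q(\tilde S,S)=E_{Q,S}\|\tilde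 S-S\|^2$. Basis and coefficients. $(\phi_j)_{1\le j\le p}$ are $1$-periodic functions in $L_2[0,1]$ with $\frac1p\sum_{l=1}^p\phi_i(t_l)\phi_j(t_l)=\mathbf 1_{\{i=j\}}$ and $\sup_{1\le j\le p}\sup_{0\le t\le1}|\phi_j(t)|\le\phi_*<\infty$ ($\phi_*\ge1$, possibly depending on $n$). Put $\psi_j(t)=\sum_{k=1}^{np}\phi_j(t_k)\mathbf 1_{(t_{k-1},t_k]}(t)$, $\bar\theta_j=(S,\psi_j)$, $\hat\theta_j=\frac1n\sum_{l=1}^{np}\phi_j(t_l)(y_{t_l}-y_{t_{l-1}})$, $\xi_j=n^{-1/2}I_n(\psi_j)$, so $\hat\theta_j=\bar\theta_j+n^{-1/2}\xi_j$. Condition $\mathbf H_1$: $\varkappa^*=\sup_{Q\in\mathcal Q_n}\varkappa_Q<\infty$, and $n^{-\epsilon}\varkappa^*\to0$ as $n\to\infty$ for every $\epsilon>0$. Condition $\mathbf H_2$ (at $(n,p,d)$, with $d\le p$): there is a $\sigma$-field $\mathcal G$ such that for every $Q\in\mathcal Q_n$ the vector $(\xi_j)_{1\le j\le d}$ is $\mathcal G$-conditionally (centered) Gaussian with covariance matrix $G=G_Q=(E_Q(\xi_i\xi_j|\mathcal G))_{1\le i,j\le d}$, and for some nonrandom constant $l_*=l_*(p,d)>0$, $\inf_{Q\in\mathcal Q_n}(\mathrm{tr}\,G-\lambda_{\max}(G))\ge l_*$ a.s., where $\lambda_{\max}$ is the maximal eigenvalue. (In general $\mathbf H_2$ asks for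 this for all $p\ge p_0$ and all $d\ge d_0$, for some $p_0,d_0\ge1$.) Weights. $\Gamma\subset[0,1]^p$ is a finite set of vectors $\gamma=(\gamma(j))_{1\le j\le p}$, $\nu=\#\Gamma$, $\nu_*=\max_{\gamma\in\Gamma}\sum_{j=1}^p\gamma(j)$. Condition $\mathbf H_3$: for every $\gamma\in\Gamma$ there is a fixed integer $d=d(\gamma)\le p$ with $\gamma(j)=1$ for $1\le j\le d$; moreover $\nu=\nu(n)$ and $\nu_*=\nu_*(n)$ satisfy $\nu/n^\epsilon\to0$ and $\nu_*/n^{1/3+\epsilon}\to0$ as $n\to\infty$ for every $\epsilon>0$. Estimators. $\hat S_\gamma(t)=\sum_{j=1}^p\gamma(j)\hat\theta_j\psi_j(t)$ and $S^*_\gamma(t)=\sum_{j=1}^p\gamma(j)\theta^*_j\psi_j(t)$, where $\theta_j^*=(1-g(j))\hat\theta_j$, $g(j)=\frac{c_n}{|\hat\theta|_d}\mathbf 1_{\{1\le j\le d\}}$, with $d=d(\gamma)$ and $c_n$ as in the claim. Here $r=r_n>0$ is a parameter with $n^{-\epsilon}r_n\to0$ for every $\epsilon>0$. *)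

theory Defs
  imports "HOL-Probability.Probability" "Jordan_Normal_Form.Char_Poly"
begin

section \<open>The spaces L2[a,b] and D[0,T]\<close>

definition L2_on :: "real \<Rightarrow> real \<Rightarrow> (real \<Rightarrow> real) \<Rightarrow> bool" where
  "L2_on a b f \<longleftrightarrow> set_borel_measurable lborel {a..b} f
     \<and> set_integrable lborel {a..b} (\<lambda>t. (f t)\<^sup>2)"

text \<open>The norm of L2[0,1].\<close>

definition L2_norm_unit :: "(real \<Rightarrow> real) \<Rightarrow> real" where
  "L2_norm_unit f = sqrt (set_lebesgue_integral lborel {0..1} (\<lambda>t. (f t)\<^sup>2))"

definition periodic1 :: "(real \<Rightarrow> real) \<Rightarrow> bool" where
  "periodic1 f \<longleftrightarrow> (\<forall>t. f (t + 1) = f t)"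

definition cadlag :: "real \<Rightarrow> (real \<Rightarrow> real) \<Rightarrow> bool" where
  "cadlag T x \<longleftrightarrow> (\<forall>t\<in>{0..<T}. (x \<longlongrightarrow> x t) (at_right t))
     \<and> (\<forall>t\<in>{0<..T}. \<exists>l. (x \<longlongrightarrow> l) (at_left t))"

text \<open>The Borel \<open>\<sigma>\<close>-field of the Skorokhod topology on D[0,T] is the one generated by the
  coordinate maps, which is the one used here.\<close>

definition skorokhod :: "real \<Rightarrow> (real \<Rightarrow> real) measure" where
  "skorokhod T = restrict_space (\<Pi>\<^sub>M t\<in>{0..T}. (borel :: real measure)) {x. cadlag T x}"


section \<open>Semimartingales on [0,T]\<close>

definition adapted :: "real \<Rightarrow> (real \<Rightarrow> 'w measure) \<Rightarrow> (real \<Rightarrow> 'w \<Rightarrow> real) \<Rightarrow> bool" where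
  "adapted T F X \<longleftrightarrow> (\<forall>t\<in>{0..T}. X t \<in> borel_measurable (F t))"

definition martingale_on ::
    "'w measure \<Rightarrow> real \<Rightarrow> (real \<Rightarrow> 'w measure) \<Rightarrow> (real \<Rightarrow> 'w \<Rightarrow> real) \<Rightarrow> bool" where
  "martingale_on M T F X \<longleftrightarrow> adapted T F X \<and> (\<forall>t\<in>{0..T}. integrable M (X t))
     \<and> (\<forall>s t. 0 \<le> s \<and> s \<le> t \<and> t \<le> T \<longrightarrow> (AE \<omega> in M. real_cond_exp M (F s) (X t) \<omega> = X s \<omega>))"

text \<open>On the compact time interval [0,T] the localizing stopping times have to reach T after
  finitely many steps.\<close>

definition local_martingale_on ::
    "'w measure \<Rightarrow> real \<Rightarrow> (real \<Rightarrow> 'w measure) \<Rightarrow> (real \<Rightarrow> 'w \<Rightarrow> real) \<Rightarrow> bool" where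
  "local_martingale_on M T F X \<longleftrightarrow> adapted T F X \<and>
     (\<exists>\<tau> :: nat \<Rightarrow> 'w \<Rightarrow> real.
        (\<forall>k. stopping_time F (\<tau> k))
      \<and> (\<forall>k. \<forall>\<omega>\<in>space M. 0 \<le> \<tau> k \<omega>)
      \<and> (AE \<omega> in M. \<forall>k. \<tau> k \<omega> \<le> \<tau> (Suc k) \<omega>)
      \<and> (AE \<omega> in M. \<exists>k. T \<le> \<tau> k \<omega>)
      \<and> (\<forall>k. martingale_on M T F (\<lambda>t \<omega>. X (min t (\<tau> k \<omega>)) \<omega> - X 0 \<omega>)))"

definition finite_variation :: "real \<Rightarrow> (real \<Rightarrow> real) \<Rightarrow> bool" where
  "finite_variation T x \<longleftrightarrow> (\<exists>B. \<forall>(k::nat) s.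
     (\<forall>i<k. 0 \<le> s i \<and> s i \<le> s (Suc i) \<and> s (Suc i) \<le> T)
       \<longrightarrow> (\<Sum>i<k. \<bar>x (s (Suc i)) - x (s i)\<bar>) \<le> B)"

definition semimartingale :: "'w measure \<Rightarrow> real \<Rightarrow> (real \<Rightarrow> 'w \<Rightarrow> real) \<Rightarrow> bool" where
  "semimartingale M T X \<longleftrightarrow>
     (\<exists>F L A. filtration (space M) F \<and> (\<forall>t. subalgebra M (F t)) \<and> adapted T F X
      \<and> local_martingale_on M T F L \<and> (AE \<omega> in M. cadlag T (\<lambda>t. L t \<omega>))
      \<and> adapted T F A \<and> (AE \<omega> in M. cadlag T (\<lambda>t. A t \<omega>) \<and> finite_variation T (\<lambda>t. A t \<omega>))
      \<and> (AE \<omega> in M. \<forall>t\<in>{0..T}. X t \<omega> = X 0 \<omega> + (L t \<omega> - L 0 \<omega>) + (A t \<omega> - A 0 \<omega>)))"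

definition square_integrable_semimartingale ::
    "'w measure \<Rightarrow> real \<Rightarrow> (real \<Rightarrow> 'w \<Rightarrow> real) \<Rightarrow> bool" where
  "square_integrable_semimartingale M T X \<longleftrightarrow> semimartingale M T X
     \<and> (\<forall>t\<in>{0..T}. X t \<in> borel_measurable M \<and> integrable M (\<lambda>\<omega>. (X t \<omega>)\<^sup>2))"


section \<open>Stochastic integral of deterministic functions\<close>

text \<open>\<open>stochastic_integral M T X J\<close>: the operator \<open>J\<close> is (a version of) the stochastic integral
  of deterministic functions of L2[0,T] over (0,T] with respect to X.  Linearity, the value on
  intervals and the dominated convergence theorem in probability determine \<open>J f\<close> up to
  null sets.  Convergence is only asked for on (0,T], so that \<open>J f\<close> does not depend on \<open>f 0\<close> or on
  the values of \<open>f\<close> outside [0,T].\<close>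

definition stochastic_integral ::
    "'w measure \<Rightarrow> real \<Rightarrow> (real \<Rightarrow> 'w \<Rightarrow> real) \<Rightarrow> ((real \<Rightarrow> real) \<Rightarrow> 'w \<Rightarrow> real) \<Rightarrow> bool" where
  "stochastic_integral M T X J \<longleftrightarrow>
     (\<forall>f. L2_on 0 T f \<longrightarrow> J f \<in> borel_measurable M)
   \<and> (\<forall>s t. 0 \<le> s \<and> s \<le> t \<and> t \<le> T \<longrightarrow>
        (AE \<omega> in M. J (indicator {s<..t}) \<omega> = X t \<omega> - X s \<omega>))
   \<and> (\<forall>f g a b. L2_on 0 T f \<longrightarrow> L2_on 0 T g \<longrightarrow>
        (AE \<omega> in M. J (\<lambda>t. a * f t + b * g t) \<omega> = a * J f \<omega> + b * J g \<omega>))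
   \<and> (\<forall>f h g. L2_on 0 T f \<longrightarrow> (\<forall>k::nat. L2_on 0 T (h k)) \<longrightarrow> L2_on 0 T g \<longrightarrow>
        (\<forall>k. \<forall>t\<in>{0<..T}. \<bar>h k t\<bar> \<le> g t) \<longrightarrow>
        (\<forall>t\<in>{0<..T}. (\<lambda>k. h k t) \<longlonglongrightarrow> f t) \<longrightarrow>
        (\<forall>\<epsilon>>0. (\<lambda>k. measure M {\<omega>\<in>space M. \<bar>J (h k) \<omega> - J f \<omega>\<bar> > \<epsilon>}) \<longlonglongrightarrow> 0))"


section \<open>The noise model\<close>

text \<open>\<open>\<Q>\<close> is a family of laws on D[0,n].  For a law \<open>Q\<close> of this family, \<open>P Q\<close> is the
  underlying probability measure, under which the noise \<open>\<xi>\<close> has distribution \<open>Q\<close>, and \<open>J Q f\<close> is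
  the integral \<open>I\<^sub>n(f)\<close>.  The probability space may carry more randomness than the path of \<open>\<xi>\<close>;
  the canonical space is \<open>P Q = Q\<close>, \<open>\<xi> t \<omega> = \<omega> t\<close>.\<close>

definition noise_model ::
    "nat \<Rightarrow> (real \<Rightarrow> real) measure set \<Rightarrow> ((real \<Rightarrow> real) measure \<Rightarrow> 'w measure)
     \<Rightarrow> (real \<Rightarrow> 'w \<Rightarrow> real) \<Rightarrow> ((real \<Rightarrow> real) measure \<Rightarrow> (real \<Rightarrow> real) \<Rightarrow> 'w \<Rightarrow> real)
     \<Rightarrow> ((real \<Rightarrow> real) measure \<Rightarrow> real) \<Rightarrow> bool" where
  "noise_model n \<Q> P \<xi> J \<kappa> \<longleftrightarrow> (\<forall>Q\<in>\<Q>.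
     prob_space (P Q)
   \<and> (\<lambda>\<omega>. \<lambda>t\<in>{0..real n}. \<xi> t \<omega>) \<in> P Q \<rightarrow>\<^sub>M skorokhod (real n)
   \<and> distr (P Q) (skorokhod (real n)) (\<lambda>\<omega>. \<lambda>t\<in>{0..real n}. \<xi> t \<omega>) = Q
   \<and> square_integrable_semimartingale (P Q) (real n) \<xi>
   \<and> stochastic_integral (P Q) (real n) \<xi> (J Q)
   \<and> 0 < \<kappa> Q
   \<and> (\<forall>f. L2_on 0 (real n) f \<longrightarrow>
        integrable (P Q) (\<lambda>\<omega>. (J Q f \<omega>)\<^sup>2)
      \<and> integral\<^sup>L (P Q) (J Q f) = 0
      \<and> integral\<^sup>L (P Q) (\<lambda>\<omega>. (J Q f \<omega>)\<^sup>2)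
          \<le> \<kappa> Q * set_lebesgue_integral lborel {0..real n} (\<lambda>s. (f s)\<^sup>2)))"

text \<open>The observed process \<open>dy\<^sub>t = S(t) dt + d\<xi>\<^sub>t\<close> with initial value \<open>y0\<close>.\<close>

definition observation ::
    "('w \<Rightarrow> real) \<Rightarrow> (real \<Rightarrow> 'w \<Rightarrow> real) \<Rightarrow> (real \<Rightarrow> real) \<Rightarrow> 'w \<Rightarrow> real \<Rightarrow> real" where
  "observation y0 \<xi> S \<omega> t =
     y0 \<omega> + set_lebesgue_integral lborel {0..t} S + (\<xi> t \<omega> - \<xi> 0 \<omega>)"

text \<open>The risk of an estimator, i.e. of a map from observed paths to functions.  It takes values
  in [0,\<open>\<infinity>\<close>], so it is meaningful without an integrability assumption.\<close>

definition quadratic_risk ::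
    "'w measure \<Rightarrow> ('w \<Rightarrow> real \<Rightarrow> real) \<Rightarrow> ((real \<Rightarrow> real) \<Rightarrow> real \<Rightarrow> real) \<Rightarrow> (real \<Rightarrow> real) \<Rightarrow> ennreal"
  where
  "quadratic_risk M y est S =
     (\<integral>\<^sup>+ \<omega>. ennreal ((L2_norm_unit (\<lambda>t. est (y \<omega>) t - S t))\<^sup>2) \<partial>M)"

definition lipschitz_signals :: "real \<Rightarrow> (real \<Rightarrow> real) set" where
  "lipschitz_signals r =
     {S. periodic1 S \<and> (\<exists>L. L-lipschitz_on UNIV S) \<and> L2_norm_unit S \<le> r}"


section \<open>Basis, coefficients and estimators\<close>

definition grid :: "nat \<Rightarrow> nat \<Rightarrow> real" where
  "grid p k = real k / real p"

definition discrete_basis :: "nat \<Rightarrow> (nat \<Rightarrow> real \<Rightarrow> real) \<Rightarrow> real \<Rightarrow> bool" where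
  "discrete_basis p \<phi> \<phi>\<^sub>s \<longleftrightarrow>
     (\<forall>j\<in>{1..p}. periodic1 (\<phi> j) \<and> L2_on 0 1 (\<phi> j))
   \<and> (\<forall>i\<in>{1..p}. \<forall>j\<in>{1..p}.
        (1 / real p) * (\<Sum>l=1..p. \<phi> i (grid p l) * \<phi> j (grid p l)) = (if i = j then 1 else 0))
   \<and> 1 \<le> \<phi>\<^sub>s \<and> (\<forall>j\<in>{1..p}. \<forall>t\<in>{0..1}. \<bar>\<phi> j t\<bar> \<le> \<phi>\<^sub>s)"

definition psi :: "nat \<Rightarrow> nat \<Rightarrow> (nat \<Rightarrow> real \<Rightarrow> real) \<Rightarrow> nat \<Rightarrow> real \<Rightarrow> real" where
  "psi n p \<phi> j t =
     (\<Sum>k=1..n*p. \<phi> j (grid p k) * indicator {grid p (k - 1)<..grid p k} t)"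

definition theta_hat ::
    "nat \<Rightarrow> nat \<Rightarrow> (nat \<Rightarrow> real \<Rightarrow> real) \<Rightarrow> (real \<Rightarrow> real) \<Rightarrow> nat \<Rightarrow> real" where
  "theta_hat n p \<phi> y j =
     (1 / real n) * (\<Sum>l=1..n*p. \<phi> j (grid p l) * (y (grid p l) - y (grid p (l - 1))))"

text \<open>The noise coefficient \<open>\<xi>\<^sub>j\<close>; here \<open>J\<close> is the integral \<open>I\<^sub>n\<close>.\<close>

definition xi_coef ::
    "nat \<Rightarrow> nat \<Rightarrow> (nat \<Rightarrow> real \<Rightarrow> real) \<Rightarrow> ((real \<Rightarrow> real) \<Rightarrow> 'w \<Rightarrow> real) \<Rightarrow> nat \<Rightarrow> 'w \<Rightarrow> real" where
  "xi_coef n p \<phi> J j \<omega> = J (psi n p \<phi> j) \<omega> / sqrt (real n)"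

definition norm_d :: "nat \<Rightarrow> (nat \<Rightarrow> real) \<Rightarrow> real" where
  "norm_d d x = sqrt (\<Sum>j=1..d. (x j)\<^sup>2)"

definition S_hat ::
    "nat \<Rightarrow> nat \<Rightarrow> (nat \<Rightarrow> real \<Rightarrow> real) \<Rightarrow> (nat \<Rightarrow> real) \<Rightarrow> (real \<Rightarrow> real) \<Rightarrow> real \<Rightarrow> real" where
  "S_hat n p \<phi> \<gamma> y t = (\<Sum>j=1..p. \<gamma> j * theta_hat n p \<phi> y j * psi n p \<phi> j t)"

text \<open>On the event \<open>norm_d d (theta_hat n p \<phi> y) = 0\<close>, division by zero gives shrinkage
  factor 0; there \<open>theta_star\<close> is 0 for \<open>j \<le> d\<close> with any value of the factor.\<close>

definition shrink_factor ::
    "nat \<Rightarrow> nat \<Rightarrow> (nat \<Rightarrow> real \<Rightarrow> real) \<Rightarrow> nat \<Rightarrow> real \<Rightarrow> (real \<Rightarrow> real) \<Rightarrow> nat \<Rightarrow> real" where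
  "shrink_factor n p \<phi> d c y j =
     (if 1 \<le> j \<and> j \<le> d then c / norm_d d (theta_hat n p \<phi> y) else 0)"

definition theta_star ::
    "nat \<Rightarrow> nat \<Rightarrow> (nat \<Rightarrow> real \<Rightarrow> real) \<Rightarrow> nat \<Rightarrow> real \<Rightarrow> (real \<Rightarrow> real) \<Rightarrow> nat \<Rightarrow> real" where
  "theta_star n p \<phi> d c y j = (1 - shrink_factor n p \<phi> d c y j) * theta_hat n p \<phi> y j"

definition S_star ::
    "nat \<Rightarrow> nat \<Rightarrow> (nat \<Rightarrow> real \<Rightarrow> real) \<Rightarrow> nat \<Rightarrow> real \<Rightarrow> (nat \<Rightarrow> real)
     \<Rightarrow> (real \<Rightarrow> real) \<Rightarrow> real \<Rightarrow> real" where
  "S_star n p \<phi> d c \<gamma> y t = (\<Sum>j=1..p. \<gamma> j * theta_star n p \<phi> d c y j * psi n p \<phi> j t)"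


section \<open>Conditionally Gaussian vectors\<close>

text \<open>Vectors of length \<open>d\<close> and \<open>d \<times> d\<close> matrices are indexed by \<open>{..<d}\<close> in this section.

  The (possibly degenerate) centered Gaussian law with covariance matrix \<open>C\<close>: the law of \<open>A Z\<close>,
  where \<open>Z\<close> is a vector of independent standard normal variables and \<open>A A\<^sup>T = C\<close>.\<close>

definition gaussian_law :: "nat \<Rightarrow> real mat \<Rightarrow> (nat \<Rightarrow> real) measure \<Rightarrow> bool" where
  "gaussian_law d C \<mu> \<longleftrightarrow> (\<exists>A\<in>carrier_mat d d. C = A * transpose_mat A \<and>
     \<mu> = distr (\<Pi>\<^sub>M k\<in>{..<d}. density lborel std_normal_density) (\<Pi>\<^sub>M i\<in>{..<d}. borel)
           (\<lambda>z. \<lambda>i\<in>{..<d}. \<Sum>k<d. A $$ (i, k) * z k))"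

definition cond_cov ::
    "'w measure \<Rightarrow> 'w measure \<Rightarrow> nat \<Rightarrow> (nat \<Rightarrow> 'w \<Rightarrow> real) \<Rightarrow> 'w \<Rightarrow> real mat" where
  "cond_cov M \<G> d X \<omega> =
     mat d d (\<lambda>(i, j). real_cond_exp M \<G> (\<lambda>\<omega>'. X i \<omega>' * X j \<omega>') \<omega>)"

text \<open>\<open>K\<close> is the regular conditional distribution of the vector given \<open>\<G>\<close>.\<close>

definition cond_gaussian ::
    "'w measure \<Rightarrow> 'w measure \<Rightarrow> nat \<Rightarrow> (nat \<Rightarrow> 'w \<Rightarrow> real) \<Rightarrow> bool" where
  "cond_gaussian M \<G> d X \<longleftrightarrow>
     (\<exists>K. K \<in> \<G> \<rightarrow>\<^sub>M prob_algebra (\<Pi>\<^sub>M i\<in>{..<d}. (borel :: real measure))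
      \<and> (\<forall>B\<in>sets (\<Pi>\<^sub>M i\<in>{..<d}. (borel :: real measure)). AE \<omega> in M.
           real_cond_exp M \<G> (\<lambda>\<omega>'. indicator B (\<lambda>i\<in>{..<d}. X i \<omega>')) \<omega> = measure (K \<omega>) B)
      \<and> (AE \<omega> in M. gaussian_law d (cond_cov M \<G> d X \<omega>) (K \<omega>)))"

definition mat_tr :: "real mat \<Rightarrow> real" where
  "mat_tr A = (\<Sum>i<dim_row A. A $$ (i, i))"

text \<open>For a symmetric matrix of positive dimension the set of real eigenvalues is finite and
  nonempty.\<close>

definition lambda_max :: "real mat \<Rightarrow> real" where
  "lambda_max A = Max {k. eigenvalue A k}"


section \<open>Conditions H1, H2, H3\<close>

text \<open>The objects \<open>\<Q>\<close>, \<open>\<kappa>\<close>, \<open>p\<close>, \<open>\<Gamma>\<close>, \<open>dg\<close> of conditions H1 and H3 are sequences in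
  the number \<open>n\<close> of periods, as these conditions contain limits for \<open>n \<rightarrow> \<infinity>\<close>.\<close>

definition subpolynomial :: "(nat \<Rightarrow> real) \<Rightarrow> bool" where
  "subpolynomial a \<longleftrightarrow> (\<forall>\<epsilon>>0. (\<lambda>n. real n powr (- \<epsilon>) * a n) \<longlonglongrightarrow> 0)"

definition kappa_star ::
    "(nat \<Rightarrow> (real \<Rightarrow> real) measure set) \<Rightarrow> (nat \<Rightarrow> (real \<Rightarrow> real) measure \<Rightarrow> real) \<Rightarrow> nat \<Rightarrow> real" where
  "kappa_star \<Q> \<kappa> n = (SUP Q\<in>\<Q> n. \<kappa> n Q)"

definition H1 ::
    "(nat \<Rightarrow> (real \<Rightarrow> real) measure set) \<Rightarrow> (nat \<Rightarrow> (real \<Rightarrow> real) measure \<Rightarrow> real) \<Rightarrow> bool" where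
  "H1 \<Q> \<kappa> \<longleftrightarrow> (\<forall>n\<ge>1. bdd_above (\<kappa> n ` \<Q> n)) \<and> subpolynomial (kappa_star \<Q> \<kappa>)"

text \<open>H2 at a fixed \<open>(n,p,d)\<close> with constant \<open>l\<close>.  The coefficients \<open>\<xi>\<^sub>1, \<dots>, \<xi>\<^sub>d\<close> are shifted
  to the index set \<open>{..<d}\<close>.\<close>

definition H2 ::
    "nat \<Rightarrow> nat \<Rightarrow> nat \<Rightarrow> (nat \<Rightarrow> real \<Rightarrow> real) \<Rightarrow> (real \<Rightarrow> real) measure set
     \<Rightarrow> ((real \<Rightarrow> real) measure \<Rightarrow> 'w measure)
     \<Rightarrow> ((real \<Rightarrow> real) measure \<Rightarrow> (real \<Rightarrow> real) \<Rightarrow> 'w \<Rightarrow> real) \<Rightarrow> real \<Rightarrow> bool" where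
  "H2 n p d \<phi> \<Q> P J l \<longleftrightarrow> d \<le> p \<and> 0 < l \<and>
     (\<exists>\<G>. \<forall>Q\<in>\<Q>. subalgebra (P Q) \<G>
        \<and> cond_gaussian (P Q) \<G> d (\<lambda>i. xi_coef n p \<phi> (J Q) (Suc i))
        \<and> (AE \<omega> in P Q.
             let G = cond_cov (P Q) \<G> d (\<lambda>i. xi_coef n p \<phi> (J Q) (Suc i)) \<omega>
             in mat_tr G - lambda_max G \<ge> l))"

text \<open>A weight vector in \<open>[0,1]\<^sup>p\<close> is an extensional function on \<open>{1..p}\<close>; \<open>dg n \<gamma>\<close> is
  \<open>d(\<gamma>)\<close>.\<close>

definition nu_star :: "(nat \<Rightarrow> nat) \<Rightarrow> (nat \<Rightarrow> (nat \<Rightarrow> real) set) \<Rightarrow> nat \<Rightarrow> real" where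
  "nu_star p \<Gamma> n = Max ((\<lambda>\<gamma>. \<Sum>j=1..p n. \<gamma> j) ` \<Gamma> n)"

definition weight_sets :: "(nat \<Rightarrow> nat) \<Rightarrow> (nat \<Rightarrow> (nat \<Rightarrow> real) set) \<Rightarrow> bool" where
  "weight_sets p \<Gamma> \<longleftrightarrow> (\<forall>n\<ge>1. finite (\<Gamma> n) \<and> \<Gamma> n \<subseteq> {1..p n} \<rightarrow>\<^sub>E {0..1})"

definition H3 ::
    "(nat \<Rightarrow> nat) \<Rightarrow> (nat \<Rightarrow> (nat \<Rightarrow> real) set) \<Rightarrow> (nat \<Rightarrow> (nat \<Rightarrow> real) \<Rightarrow> nat) \<Rightarrow> bool" where
  "H3 p \<Gamma> dg \<longleftrightarrow>
     (\<forall>n\<ge>1. \<forall>\<gamma>\<in>\<Gamma> n. dg n \<gamma> \<le> p n \<and> (\<forall>j\<in>{1..dg n \<gamma>}. \<gamma> j = 1))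
   \<and> (\<forall>\<epsilon>>0. (\<lambda>n. real (card (\<Gamma> n)) / real n powr \<epsilon>) \<longlonglongrightarrow> 0)
   \<and> (\<forall>\<epsilon>>0. (\<lambda>n. nu_star p \<Gamma> n / real n powr (1 / 3 + \<epsilon>)) \<longlonglongrightarrow> 0)"

text \<open>The shrinkage constant \<open>c\<^sub>n\<close>.\<close>

definition shrink_const :: "nat \<Rightarrow> nat \<Rightarrow> real \<Rightarrow> real \<Rightarrow> real \<Rightarrow> real" where
  "shrink_const n d l r \<kappa>\<^sub>s = l / (real n * (r + sqrt (real d / real n * \<kappa>\<^sub>s)))"

end

theory Submission
  imports Defs "HOL-Real_Asymp.Real_Asymp"
begin

text \<open>Since the \<open>\<psi>\<^sub>j\<close> are orthonormal in L2[0,1] and \<open>\<gamma>\<close> is 1 on the first \<open>d\<close> coordinates, the difference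
  of the two losses is \<open>c\<^sup>2 - 2 c \<langle>u, \<sigma> \<xi>\<rangle> / |u|\<close>, where \<open>u = \<theta> + \<sigma> \<xi>\<close> is the vector of the first \<open>d\<close>
  empirical coefficients and \<open>\<sigma> = n\<^sup>-\<^sup>1\<^sup>/\<^sup>2\<close>.  Conditionally on the \<open>\<sigma>\<close>-field, \<open>\<xi>\<close> is Gaussian with covariance
  \<open>G\<close>, and Stein's identity turns the mean of \<open>\<langle>u, \<sigma> \<xi>\<rangle> / |u|\<close> into that of
  \<open>\<sigma>\<^sup>2 (tr G / |u| - \<langle>G u, u\<rangle> / |u|\<^sup>3) \<ge> \<sigma>\<^sup>2 l / |u|\<close>.  Jensen's inequality bounds the mean of \<open>1 / |u|\<close>
  below by \<open>1 / (r + \<sigma> sqrt (d \<kappa>))\<close>, so the mean of \<open>\<langle>u, \<sigma> \<xi>\<rangle> / |u|\<close> is at least \<open>c\<close>.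

  The singularity of \<open>u / |u|\<close> at the origin is avoided by replacing \<open>|u|\<close> with
  \<open>sqrt (|u|\<^sup>2 + \<epsilon>\<^sup>2)\<close>, for which Stein's identity holds coordinatewise with bounded smooth functions
  even if \<open>G\<close> is degenerate; only the final inequality is passed to the limit \<open>\<epsilon> \<rightarrow> 0\<close>.
  As the bound \<open>l\<close> is nonrandom, of the conditional law only the fact that it mixes to the law of \<open>\<xi>\<close>
  is needed.\<close>

section \<open>Stein's identity for standard normal variables\<close>

lemma std_normal_density_deriv:
  "(std_normal_density has_real_derivative - x * std_normal_density x) (at x)"
proof -
  have "((\<lambda>x. exp (- x\<^sup>2 / 2)) has_real_derivative - x * exp (- x\<^sup>2 / 2)) (at x)"
    by (auto intro!: derivative_eq_intros)
  from DERIV_cmult[OF this, of "1 / sqrt (2 * pi)"] show ?thesis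
    unfolding std_normal_density_def by (simp add: mult.left_commute)
qed

lemma std_normal_density_at_infinity:
  "(std_normal_density \<longlongrightarrow> 0) at_top" "(std_normal_density \<longlongrightarrow> 0) at_bot"
  unfolding std_normal_density_def by real_asymp+

lemma integrable_std_normal_id: "integrable std_normal_distribution (\<lambda>x. x)"
  using integrable_std_normal_distribution_moment[of 1] by simp

text \<open>Integration by parts: the normal density has logarithmic derivative \<open>- x\<close>,
  so the density times \<open>f\<close> has derivative \<open>?g\<close>, and its limits at both
  infinities vanish because \<open>f\<close> is bounded.\<close>

lemma std_normal_stein:
  fixes f f' :: "real \<Rightarrow> real"
  assumes deriv: "\<And>x. (f has_real_derivative f' x) (at x)"
    and cont: "continuous_on UNIV f'"
    and bound: "\<And>x. \<bar>f x\<bar> \<le> B" and bound': "\<And>x. \<bar>f' x\<bar> \<le> B'"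
  shows "(\<integral>x. x * f x \<partial>std_normal_distribution) = (\<integral>x. f' x \<partial>std_normal_distribution)"
proof -
  have contf: "continuous_on UNIV f"
    using deriv DERIV_isCont by (blast intro: continuous_at_imp_continuous_on)
  have [measurable]: "f \<in> borel_measurable borel" "f' \<in> borel_measurable borel"
    using contf cont by (auto intro: borel_measurable_continuous_onI)
  interpret N: prob_space std_normal_distribution
    by (rule prob_space_normal_density) simp
  have int1: "integrable std_normal_distribution (\<lambda>x. x * f x)"
    by (rule Bochner_Integration.integrable_bound[OF integrable_mult_left[OF integrable_abs[OF integrable_std_normal_id], of B]])
      (auto simp: abs_mult intro!: AE_I2 mult_left_mono order.trans[OF bound])
  have int2: "integrable std_normal_distribution f'"
    using bound' by (intro N.integrable_const_bound[where B = B']) auto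
  let ?g = "\<lambda>x. std_normal_density x * f' x - std_normal_density x * (x * f x)"
  have int: "integrable lborel (\<lambda>x. std_normal_density x * (x * f x))"
      "integrable lborel (\<lambda>x. std_normal_density x * f' x)"
    using int1 int2 by (auto simp: integrable_density)
  have lim: "((\<lambda>x. std_normal_density x * f x) \<longlongrightarrow> 0) F"
    if "(std_normal_density \<longlongrightarrow> 0) F" for F
  proof (rule Lim_null_comparison[OF _ tendsto_mult_right_zero[OF that, of B]])
    show "\<forall>\<^sub>F x in F. norm (std_normal_density x * f x) \<le> B * std_normal_density x"
      using bound by (auto simp: abs_mult mult.commute intro!: always_eventually mult_right_mono)
  qed
  have "(LBINT x=-\<infinity>..\<infinity>. ?g x) = 0 - 0"
  proof (rule interval_integral_FTC_integrable[where F = "\<lambda>x. std_normal_density x * f x"])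
    fix x
    show "((\<lambda>x. std_normal_density x * f x) has_vector_derivative ?g x) (at x)"
      unfolding has_real_derivative_iff_has_vector_derivative[symmetric]
      by (auto intro!: derivative_eq_intros std_normal_density_deriv deriv simp: algebra_simps)
    have "isCont std_normal_density x"
      using std_normal_density_deriv DERIV_isCont by blast
    moreover have "isCont f x" "isCont f' x"
      using contf cont by (auto simp: continuous_on_eq_continuous_at)
    ultimately show "isCont ?g x"
      by (intro continuous_intros) auto
  next
    show "set_integrable lborel (einterval (- \<infinity>) \<infinity>) ?g"
      using int by (simp add: set_integrable_def einterval_def)
    show "(((\<lambda>x. std_normal_density x * f x) \<circ> real_of_ereal) \<longlongrightarrow> 0) (at_right (- \<infinity>))"
      using lim[OF std_normal_density_at_infinity(2)]
      by (simp add: ereal_tendsto_simps)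
    show "(((\<lambda>x. std_normal_density x * f x) \<circ> real_of_ereal) \<longlongrightarrow> 0) (at_left \<infinity>)"
      using lim[OF std_normal_density_at_infinity(1)]
      by (simp add: ereal_tendsto_simps)
  qed simp
  then have "(\<integral>x. ?g x \<partial>lborel) = 0"
    by (simp add: interval_lebesgue_integral_def set_lebesgue_integral_def einterval_def)
  then show ?thesis
    using int by (simp add: integral_density)
qed

text \<open>Fubini: the integral over coordinate \<open>m\<close> is taken first with the other
  coordinates frozen, and there the one-dimensional identity applies. Hence smoothness is asked for
  only along lines parallel to the axis \<open>m\<close>.\<close>

lemma std_normal_PiM_stein:
  fixes F F' :: "('i \<Rightarrow> real) \<Rightarrow> real"
  assumes I: "finite I" "m \<in> I"
    and meas: "F \<in> borel_measurable (\<Pi>\<^sub>M k\<in>I. std_normal_distribution)"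
      "F' \<in> borel_measurable (\<Pi>\<^sub>M k\<in>I. std_normal_distribution)"
    and deriv: "\<And>z t. ((\<lambda>t. F (z(m := t))) has_real_derivative F' (z(m := t))) (at t)"
    and cont: "\<And>z. continuous_on UNIV (\<lambda>t. F' (z(m := t)))"
    and bound: "\<And>z. \<bar>F z\<bar> \<le> B" and bound': "\<And>z. \<bar>F' z\<bar> \<le> B'"
  shows "integrable (\<Pi>\<^sub>M k\<in>I. std_normal_distribution) (\<lambda>z. z m * F z)" (is ?int1)
    and "integrable (\<Pi>\<^sub>M k\<in>I. std_normal_distribution) F'" (is ?int2)
    and "(\<integral>z. z m * F z \<partial>(\<Pi>\<^sub>M k\<in>I. std_normal_distribution))
       = (\<integral>z. F' z \<partial>(\<Pi>\<^sub>M k\<in>I. std_normal_distribution))"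
proof -
  let ?N = "\<Pi>\<^sub>M k\<in>I. std_normal_distribution"
  have ps: "prob_space std_normal_distribution"
    by (rule prob_space_normal_density) simp
  interpret product_prob_space "\<lambda>_. std_normal_distribution" I
    by (intro product_prob_spaceI ps)
  note [measurable] = meas
  have cmp[measurable]: "(\<lambda>z. z m) \<in> ?N \<rightarrow>\<^sub>M std_normal_distribution"
    using I by measurable
  then have [measurable]: "(\<lambda>z. z m) \<in> borel_measurable ?N"
    by simp
  have "integrable (distr ?N std_normal_distribution (\<lambda>z. z m)) (\<lambda>x. x)"
    by (subst distr_PiM_component) (use I ps integrable_std_normal_id in auto)
  then have id: "integrable ?N (\<lambda>z. z m)"
    by (subst (asm) integrable_distr_eq) auto
  show int1: ?int1
    by (rule Bochner_Integration.integrable_bound[OF integrable_mult_left[OF integrable_abs[OF id], of B]])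
      (auto simp: abs_mult intro!: AE_I2 mult_left_mono order.trans[OF bound])
  show int2: ?int2
    using bound' by (intro P.integrable_const_bound[where B = B']) auto
  have ins: "(\<integral>z. g z \<partial>?N)
      = (\<integral>z. (\<integral>t. g (z(m := t)) \<partial>std_normal_distribution) \<partial>(\<Pi>\<^sub>M k\<in>I - {m}. std_normal_distribution))"
    if "integrable ?N g" for g :: "_ \<Rightarrow> real"
    using product_integral_insert[of "I - {m}" m g] I that by (simp add: insert_absorb)
  show "(\<integral>z. z m * F z \<partial>?N) = (\<integral>z. F' z \<partial>?N)"
    unfolding ins[OF int1] ins[OF int2]
    by (auto intro!: Bochner_Integration.integral_cong
        std_normal_stein[OF deriv cont bound bound'])
qed

section \<open>The maximal eigenvalue of a symmetric matrix\<close>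

text \<open>For small positive \<open>t\<close> a positive linear term would dominate the quadratic
  one.\<close>

lemma linear_coeff_nonpos_if_quadratic_nonpos:
  fixes a b :: real
  assumes "\<And>t. 2 * t * a + t\<^sup>2 * b \<le> 0"
  shows "a \<le> 0"
proof (rule ccontr)
  assume "\<not> a \<le> 0"
  \<comment> \<open>So small that \<open>?t * \<bar>b\<bar> \<le> a\<close>; then
    \<open>2 * a + ?t * b\<close> is still at least \<open>a > 0\<close>.\<close>
  let ?t = "a / (1 + \<bar>b\<bar>)"
  have b: "1 + \<bar>b\<bar> > 0" by simp
  have "?t * b \<ge> - a"
  proof -
    have "?t * \<bar>b\<bar> \<le> a"
      using b \<open>\<not> a \<le> 0\<close> by (simp add: field_simps)
    moreover have "?t * (- b) \<le> ?t * \<bar>b\<bar>"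
      using b \<open>\<not> a \<le> 0\<close> by (intro mult_left_mono) auto
    ultimately show ?thesis by simp
  qed
  then have "?t * (2 * a + ?t * b) > 0"
    using b \<open>\<not> a \<le> 0\<close> by (intro mult_pos_pos) auto
  then show False
    using assms[of ?t] by (simp add: algebra_simps power2_eq_square)
qed

lemma finite_eigenvalues:
  fixes C :: "real mat"
  assumes "C \<in> carrier_mat d d"
  shows "finite {k. eigenvalue C k}"
proof -
  have "char_poly C \<noteq> 0"
    using degree_monic_char_poly[OF assms] by auto
  then show ?thesis
    using poly_roots_finite[of "char_poly C"] by (simp add: eigenvalue_root_char_poly[OF assms])
qed

text \<open>The maximum of the quadratic form on the unit sphere is attained, and it is stationary there,
  hence an eigenvalue.\<close>

lemma quadratic_form_le_lambda_max:
  fixes C :: "real mat"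
  assumes C: "C \<in> carrier_mat d d" and d: "d > 0"
    and sym: "\<And>i j. i < d \<Longrightarrow> j < d \<Longrightarrow> C $$ (i, j) = C $$ (j, i)"
  shows "(\<Sum>i<d. \<Sum>j<d. C $$ (i, j) * x i * x j) \<le> lambda_max C * (\<Sum>i<d. (x i)\<^sup>2)"
proof -
  define bil where "bil x y = (\<Sum>i<d. \<Sum>j<d. C $$ (i, j) * x i * y j)" for x y :: "nat \<Rightarrow> real"
  define q where "q x = bil x x" for x
  define N where "N x = (\<Sum>i<d. (x i)\<^sup>2)" for x :: "nat \<Rightarrow> real"
  \<comment> \<open>The unit sphere in the first \<open>d\<close> coordinates. Fixing the other
    coordinates at 0 and boxing the first ones in [-1,1] places it in a compact product
    (Tychonoff).\<close>
  define K where "K = (\<Pi>\<^sub>E i\<in>UNIV. if i < d then {-1..1} else {0}) \<inter> {x :: nat \<Rightarrow> real. N x = 1}"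
  have contN: "continuous_on UNIV N" and contq: "continuous_on UNIV q"
    unfolding N_def q_def bil_def by (intro continuous_intros continuous_on_product_coordinates)+
  have "compactin euclidean (\<Pi>\<^sub>E i\<in>UNIV. if i < d then {-1..1::real} else {0})"
    unfolding euclidean_product_topology[symmetric] compactin_PiE
    by simp
  then have "compact K"
    unfolding K_def by (intro compact_Int_closed closed_Collect_eq contN) auto
  moreover have "(\<lambda>i. if i = 0 then 1 else 0) \<in> K"
    using d by (auto simp: K_def N_def if_distrib[of "\<lambda>x. x\<^sup>2"] cong: if_cong)
  ultimately obtain x0 where x0: "x0 \<in> K" and max: "\<And>y. y \<in> K \<Longrightarrow> q y \<le> q x0"
    using continuous_attains_sup[of K q] contq continuous_on_subset by blast
  define m where "m = q x0"
  have N1: "N x0 = 1" using x0 by (simp add: K_def)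
  \<comment> \<open>Both forms are homogeneous of degree 2, so after normalizing \<open>y\<close>
    the maximum on the sphere bounds \<open>q\<close> everywhere; a vector with
    \<open>N y = 0\<close> vanishes on \<open>{..<d}\<close>.\<close>
  have le: "q y \<le> m * N y" for y
  proof (cases "N y = 0")
    case True
    then have "\<And>i. i < d \<Longrightarrow> y i = 0"
      unfolding N_def by (subst (asm) sum_nonneg_eq_0_iff) auto
    then show ?thesis
      by (simp add: True q_def bil_def)
  next
    case False
    then have pos: "N y > 0"
      unfolding N_def by (metis less_le sum_nonneg zero_le_power2)
    define y' where "y' i = (if i < d then y i / sqrt (N y) else 0)" for i
    have N': "N y' = 1"
      using pos by (simp add: N_def y'_def power_divide flip: sum_divide_distrib)
    have "- 1 \<le> y' i \<and> y' i \<le> 1" if "i < d" for i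
    proof -
      have "(y' i)\<^sup>2 \<le> N y'"
        unfolding N_def using that by (intro member_le_sum) auto
      then show ?thesis
        by (simp add: N' abs_square_le_1 abs_le_iff minus_le_iff)
    qed
    moreover have "y' i = 0" if "\<not> i < d" for i
      using that by (simp add: y'_def)
    ultimately have "y' \<in> K"
      using N' by (auto simp: K_def)
    then have "q y' \<le> m"
      by (simp add: max m_def)
    moreover have "q y' = q y / N y"
      using pos by (simp add: q_def bil_def y'_def sum_divide_distrib)
    ultimately show ?thesis
      using pos by (simp add: field_simps)
  qed
  \<comment> \<open>Half the gradient of \<open>q - m N\<close> at \<open>x0\<close>. Moving from
    \<open>x0\<close> along \<open>w\<close>, \<open>q - m N\<close> is a quadratic polynomial in
    \<open>t\<close> without constant term and with linear coefficient \<open>2 |w|\<^sup>2\<close>;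
    as it is never positive, \<open>w\<close> vanishes, which is the eigenvalue equation.\<close>
  define w where "w i = (\<Sum>j<d. C $$ (i, j) * x0 j) - m * x0 i" for i
  have bil_sym: "bil x y = bil y x" for x y
    unfolding bil_def by (subst sum.swap) (auto intro!: sum.cong simp: sym)
  have "2 * t * (\<Sum>i<d. (w i)\<^sup>2) + t\<^sup>2 * (q w - m * N w) \<le> 0" for t
  proof -
    have "q (\<lambda>i. x0 i + t * w i) = q x0 + t * bil x0 w + t * bil w x0 + t\<^sup>2 * q w"
      by (simp add: q_def bil_def algebra_simps sum.distrib sum_distrib_left power2_eq_square)
    moreover have "N (\<lambda>i. x0 i + t * w i) = N x0 + 2 * t * (\<Sum>i<d. x0 i * w i) + t\<^sup>2 * N w"
      by (simp add: N_def algebra_simps sum.distrib sum_distrib_left power2_eq_square)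
    moreover have "bil w x0 = (\<Sum>i<d. (w i)\<^sup>2) + m * (\<Sum>i<d. x0 i * w i)"
    proof -
      have "(\<Sum>j<d. C $$ (i, j) * w i * x0 j) = (w i)\<^sup>2 + m * (x0 i * w i)" for i
      proof -
        have "(w i)\<^sup>2 = w i * ((\<Sum>j<d. C $$ (i, j) * x0 j) - m * x0 i)"
          by (simp add: power2_eq_square w_def)
        then show ?thesis
          by (simp add: right_diff_distrib sum_distrib_left mult_ac)
      qed
      then show ?thesis
        by (simp add: bil_def sum.distrib sum_distrib_left)
    qed
    ultimately show ?thesis
      using le[of "\<lambda>i. x0 i + t * w i"] bil_sym[of x0 w]
      by (simp add: m_def[symmetric] N1 algebra_simps)
  qed
  then have "(\<Sum>i<d. (w i)\<^sup>2) \<le> 0"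
    by (rule linear_coeff_nonpos_if_quadratic_nonpos)
  then have "(\<Sum>i<d. (w i)\<^sup>2) = 0"
    by (simp add: antisym sum_nonneg)
  then have w0: "w i = 0" if "i < d" for i
    using that by (subst (asm) sum_nonneg_eq_0_iff) auto
  have "eigenvector C (vec d x0) m"
    unfolding eigenvector_def
  proof (intro conjI)
    show "vec d x0 \<in> carrier_vec (dim_row C)"
      using C by auto
    show "vec d x0 \<noteq> 0\<^sub>v (dim_row C)"
    proof
      assume "vec d x0 = 0\<^sub>v (dim_row C)"
      then have "x0 i = 0" if "i < d" for i
        using that C by (metis carrier_matD(1) index_vec index_zero_vec(1))
      with N1 show False by (simp add: N_def)
    qed
    show "C *\<^sub>v vec d x0 = m \<cdot>\<^sub>v vec d x0"
    proof (rule eq_vecI)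
      fix i assume "i < dim_vec (m \<cdot>\<^sub>v vec d x0)"
      then have "i < d" by simp
      then show "(C *\<^sub>v vec d x0) $ i = (m \<cdot>\<^sub>v vec d x0) $ i"
        using C w0[of i] by (simp add: scalar_prod_def w_def atLeast0LessThan)
    qed (use C in auto)
  qed
  then have "m \<le> lambda_max C"
    unfolding lambda_max_def
    by (intro Max_ge finite_eigenvalues[OF C]) (auto simp: eigenvalue_def)
  then have "m * N x \<le> lambda_max C * N x"
    by (intro mult_right_mono) (auto simp: N_def sum_nonneg)
  with le[of x] show ?thesis
    by (simp add: q_def bil_def N_def)
qed

section \<open>The smoothed direction of a Gaussian vector\<close>

context
  fixes d :: nat and \<epsilon> :: real
  assumes eps: "\<epsilon> > 0"
begin

definition smooth_norm :: "(nat \<Rightarrow> real) \<Rightarrow> real" where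
  "smooth_norm u = sqrt ((\<Sum>i<d. (u i)\<^sup>2) + \<epsilon>\<^sup>2)"

lemma smooth_norm_radicand_pos: "(\<Sum>i<d. (u i)\<^sup>2) + \<epsilon>\<^sup>2 > 0" for u :: "nat \<Rightarrow> real"
  using eps by (intro add_nonneg_pos sum_nonneg) auto

lemma smooth_norm_power2: "(smooth_norm u)\<^sup>2 = (\<Sum>i<d. (u i)\<^sup>2) + \<epsilon>\<^sup>2"
  using smooth_norm_radicand_pos[of u] by (simp add: smooth_norm_def)

lemma smooth_norm_ge: "smooth_norm u \<ge> \<epsilon>"
  unfolding smooth_norm_def using eps by (intro real_le_rsqrt) (simp add: sum_nonneg)

lemma smooth_norm_pos: "smooth_norm u > 0"
  using smooth_norm_ge[of u] eps by linarith

lemma abs_le_smooth_norm: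
  assumes "i < d"
  shows "\<bar>u i\<bar> \<le> smooth_norm u"
proof -
  have "(u i)\<^sup>2 \<le> (\<Sum>i<d. (u i)\<^sup>2)"
    using assms by (intro member_le_sum) auto
  then show ?thesis
    unfolding smooth_norm_def by (intro real_le_rsqrt) (auto intro: add_increasing2)
qed

text \<open>The resulting bound on the quotient by the smoothed norm does not depend on
  \<open>\<epsilon>\<close>: this is what later allows dominated convergence.\<close>

lemma abs_linear_form_le_smooth_norm:
  "\<bar>\<Sum>i<d. b i * u i\<bar> \<le> (\<Sum>i<d. \<bar>b i\<bar>) * smooth_norm u"
proof -
  have "\<bar>\<Sum>i<d. b i * u i\<bar> \<le> (\<Sum>i<d. \<bar>b i * u i\<bar>)"
    by (rule sum_abs)
  also have "\<dots> \<le> (\<Sum>i<d. \<bar>b i\<bar> * smooth_norm u)"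
    by (intro sum_mono) (auto simp: abs_mult intro!: mult_left_mono abs_le_smooth_norm)
  finally show ?thesis
    by (simp add: sum_distrib_right)
qed

text \<open>The quotient rule, the smoothed norm itself having derivative
  \<open>\<langle>b, u\<rangle> / |u|\<close>. With \<open>b\<close> a column of
  \<open>\<sigma>\<close> times a square root of the covariance and summed over all columns, the
  right-hand side becomes \<open>\<sigma>\<^sup>2\<close> times the trace over the norm minus the
  quadratic form over its cube.\<close>

lemma smooth_direction_deriv:
  fixes u :: "nat \<Rightarrow> real \<Rightarrow> real"
  assumes u: "\<And>i. i < d \<Longrightarrow> (u i has_real_derivative b i) (at t)"
  shows "((\<lambda>t. (\<Sum>i<d. b i * u i t) / smooth_norm (\<lambda>i. u i t)) has_real_derivative
      (\<Sum>i<d. (b i)\<^sup>2) / smooth_norm (\<lambda>i. u i t)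
        - (\<Sum>i<d. b i * u i t)\<^sup>2 / (smooth_norm (\<lambda>i. u i t)) ^ 3) (at t)"
proof -
  let ?s = "smooth_norm (\<lambda>i. u i t)" and ?L = "\<Sum>i<d. b i * u i t"
  have s: "?s > 0" by (rule smooth_norm_pos)
  have "((\<lambda>t. (\<Sum>i<d. (u i t)\<^sup>2) + \<epsilon>\<^sup>2) has_real_derivative 2 * ?L) (at t)"
    by (auto intro!: derivative_eq_intros u simp: sum_distrib_left mult_ac)
  from DERIV_chain2[OF DERIV_real_sqrt[OF smooth_norm_radicand_pos[of "\<lambda>i. u i t"]] this]
  have ds: "((\<lambda>t. smooth_norm (\<lambda>i. u i t)) has_real_derivative ?L / ?s) (at t)"
    by (simp add: smooth_norm_def field_simps)
  have dL: "((\<lambda>t. \<Sum>i<d. b i * u i t) has_real_derivative (\<Sum>i<d. (b i)\<^sup>2)) (at t)"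
    by (auto intro!: derivative_eq_intros u simp: power2_eq_square)
  show ?thesis
    by (rule DERIV_cong[OF DERIV_divide[OF dL ds]])
      (use s in \<open>auto simp: field_simps power2_eq_square power3_eq_cube\<close>)
qed

lemma smooth_norm_continuous [continuous_intros]:
  "(\<And>i. i < d \<Longrightarrow> continuous_on T (u i)) \<Longrightarrow> continuous_on T (\<lambda>t. smooth_norm (\<lambda>i. u i t))"
  unfolding smooth_norm_def by (intro continuous_intros) auto

lemma smooth_norm_measurable [measurable (raw)]:
  "(\<And>i. i < d \<Longrightarrow> u i \<in> borel_measurable M) \<Longrightarrow> (\<lambda>z. smooth_norm (\<lambda>i. u i z)) \<in> borel_measurable M"
  unfolding smooth_norm_def
  by (intro measurable_compose[OF _ borel_measurable_sqrt] borel_measurable_add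
      borel_measurable_sum borel_measurable_power borel_measurable_const) auto

text \<open>The vector is \<open>A z\<close> with independent standard normal \<open>z\<close>, so
  \<open>\<langle>u, \<sigma> x\<rangle>\<close> splits into terms \<open>z m\<close> times the
  product of column \<open>m\<close> with \<open>u\<close>, and Stein's identity is applied in each
  \<open>z m\<close>; as only \<open>A\<close> enters, \<open>C\<close> may be singular. Subtracting
  the target bound inside \<open>H\<close> turns the inequality into the sign of one integral, which
  is easily mixed over conditional laws.\<close>

lemma gaussian_stein_bound:
  fixes a :: "nat \<Rightarrow> real" and C :: "real mat" and \<sigma> :: real
  assumes d: "d > 0" and gauss: "gaussian_law d C \<mu>" and l: "l \<le> mat_tr C - lambda_max C"
  defines "H \<equiv> \<lambda>x. (\<Sum>i<d. (a i + \<sigma> * x i) * (\<sigma> * x i)) / smooth_norm (\<lambda>i. a i + \<sigma> * x i)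
      - \<sigma>\<^sup>2 * l / smooth_norm (\<lambda>i. a i + \<sigma> * x i)"
  shows "integrable \<mu> H" and "(\<integral>x. H x \<partial>\<mu>) \<ge> 0"
proof -
  from gauss obtain A where A: "A \<in> carrier_mat d d" and CA: "C = A * transpose_mat A"
    and mu: "\<mu> = distr (\<Pi>\<^sub>M k\<in>{..<d}. std_normal_distribution) (\<Pi>\<^sub>M i\<in>{..<d}. borel)
           (\<lambda>z. \<lambda>i\<in>{..<d}. \<Sum>k<d. A $$ (i, k) * z k)"
    unfolding gaussian_law_def by blast
  let ?N = "\<Pi>\<^sub>M k\<in>{..<d}. std_normal_distribution"
  \<comment> \<open>\<open>B\<close> is \<open>\<sigma> A\<close>, so \<open>u z\<close> is
    \<open>a + B z\<close>; \<open>F m\<close> pairs column \<open>m\<close> of \<open>B\<close>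
    with the smoothed direction of \<open>u z\<close>, and \<open>F' m\<close> is its partial
    derivative in \<open>z m\<close>.\<close>
  define B where "B i k = \<sigma> * A $$ (i, k)" for i k
  define u where "u z i = a i + (\<Sum>k<d. B i k * z k)" for z i
  define F where "F m z = (\<Sum>i<d. B i m * u z i) / smooth_norm (u z)" for m z
  define F' where "F' m z = (\<Sum>i<d. (B i m)\<^sup>2) / smooth_norm (u z)
      - (\<Sum>i<d. B i m * u z i)\<^sup>2 / (smooth_norm (u z)) ^ 3" for m z
  interpret product_prob_space "\<lambda>_. std_normal_distribution" "{..<d}"
    by (intro product_prob_spaceI prob_space_normal_density) simp
  have cmp[measurable]: "(\<lambda>z. z k) \<in> borel_measurable ?N" if "k < d" for k
    using measurable_component_singleton[of k "{..<d}" "\<lambda>_. std_normal_distribution"] that by simp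
  have [measurable]: "(\<lambda>z. u z i) \<in> borel_measurable ?N" for i
    unfolding u_def by measurable
  have [measurable]: "(\<lambda>z. smooth_norm (u z)) \<in> borel_measurable ?N"
    using smooth_norm_measurable[of "\<lambda>i z. u z i" ?N] by simp
  have [measurable]: "F m \<in> borel_measurable ?N" "F' m \<in> borel_measurable ?N" for m
    unfolding F_def F'_def by measurable
  have du: "((\<lambda>t. u (z(m := t)) i) has_real_derivative B i m) (at t)" if "m < d" for z m t i
  proof -
    have "((\<lambda>t. a i + (\<Sum>k<d. B i k * (if k = m then t else z k))) has_real_derivative
        0 + (\<Sum>k<d. if k = m then B i k else 0)) (at t)"
      by (intro DERIV_add DERIV_const DERIV_sum) (auto intro!: derivative_eq_intros)
    then show ?thesis
      using that by (simp add: u_def fun_upd_def)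
  qed
  have contu: "continuous_on UNIV (\<lambda>t. u (z(m := t)) i)" if "m < d" for z m i
    using du[OF that] DERIV_isCont by (blast intro: continuous_at_imp_continuous_on)
  have stein: "integrable ?N (\<lambda>z. z m * F m z)" "integrable ?N (F' m)"
    "(\<integral>z. z m * F m z \<partial>?N) = (\<integral>z. F' m z \<partial>?N)" if m: "m < d" for m
  proof -
    have deriv: "((\<lambda>t. F m (z(m := t))) has_real_derivative F' m (z(m := t))) (at t)" for z t
      unfolding F_def F'_def by (rule smooth_direction_deriv) (rule du[OF m])
    have cont: "continuous_on UNIV (\<lambda>t. F' m (z(m := t)))" for z
      unfolding F'_def using smooth_norm_pos
      by (intro continuous_intros contu[OF m] smooth_norm_continuous[of UNIV "\<lambda>i t. u (z(m := t)) i", simplified])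
        (auto simp: less_imp_neq[symmetric])
    have bound: "\<bar>F m z\<bar> \<le> (\<Sum>i<d. \<bar>B i m\<bar>)" for z
      using abs_linear_form_le_smooth_norm[of "\<lambda>i. B i m" "u z"] smooth_norm_pos[of "u z"]
      by (simp add: F_def divide_le_eq)
    \<comment> \<open>\<open>F' m\<close> is the squared length of column \<open>m\<close> minus
      \<open>(F m)\<^sup>2\<close>, over the smoothed norm: the numerator is bounded and the
      denominator is at least \<open>\<epsilon>\<close>. The bound blows up as
      \<open>\<epsilon>\<close> tends to 0, so the limit is taken only after Stein's
      identity.\<close>
    have bound': "\<bar>F' m z\<bar> \<le> ((\<Sum>i<d. (B i m)\<^sup>2) + (\<Sum>i<d. \<bar>B i m\<bar>)\<^sup>2) / \<epsilon>" for z
    proof -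
      let ?s = "smooth_norm (u z)"
      have s: "?s > 0" "?s \<ge> \<epsilon>" by (rule smooth_norm_pos, rule smooth_norm_ge)
      have "F' m z = ((\<Sum>i<d. (B i m)\<^sup>2) - (F m z)\<^sup>2) / ?s"
        using s by (simp add: F'_def F_def power2_eq_square power3_eq_cube field_simps)
      moreover have "(F m z)\<^sup>2 \<le> (\<Sum>i<d. \<bar>B i m\<bar>)\<^sup>2"
        using power_mono[OF bound[of z], of 2] by simp
      moreover have "0 \<le> (\<Sum>i<d. (B i m)\<^sup>2)" by (intro sum_nonneg) simp
      ultimately have "F' m z = ((\<Sum>i<d. (B i m)\<^sup>2) - (F m z)\<^sup>2) / ?s"
          "\<bar>(\<Sum>i<d. (B i m)\<^sup>2) - (F m z)\<^sup>2\<bar> \<le> (\<Sum>i<d. (B i m)\<^sup>2) + (\<Sum>i<d. \<bar>B i m\<bar>)\<^sup>2"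
        using zero_le_power2[of "F m z"] by (auto simp only: abs_le_iff; linarith)+
      then have "\<bar>F' m z\<bar> \<le> ((\<Sum>i<d. (B i m)\<^sup>2) + (\<Sum>i<d. \<bar>B i m\<bar>)\<^sup>2) / ?s"
        using s by (simp add: divide_right_mono)
      also have "\<dots> \<le> ((\<Sum>i<d. (B i m)\<^sup>2) + (\<Sum>i<d. \<bar>B i m\<bar>)\<^sup>2) / \<epsilon>"
        using s eps by (intro divide_left_mono add_nonneg_nonneg sum_nonneg) auto
      finally show ?thesis .
    qed
    note stein = std_normal_PiM_stein[where F = "F m" and F' = "F' m" and m = m and I = "{..<d}",
        OF _ _ _ _ deriv cont bound bound']
    show "integrable ?N (\<lambda>z. z m * F m z)" "integrable ?N (F' m)"
      "(\<integral>z. z m * F m z \<partial>?N) = (\<integral>z. F' m z \<partial>?N)"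
      using m by (auto intro!: stein)
  qed
  have int_inv: "integrable ?N (\<lambda>z. \<sigma>\<^sup>2 * l / smooth_norm (u z))"
  proof (rule P.integrable_const_bound[where B = "\<bar>\<sigma>\<^sup>2 * l\<bar> / \<epsilon>"])
    show "AE z in ?N. norm (\<sigma>\<^sup>2 * l / smooth_norm (u z)) \<le> \<bar>\<sigma>\<^sup>2 * l\<bar> / \<epsilon>"
      using smooth_norm_ge smooth_norm_pos eps
      by (auto simp: abs_of_pos intro!: divide_left_mono)
  qed measurable
  \<comment> \<open>\<open>H\<close> pulled back along \<open>z \<mapsto> A z\<close>, with the
    double sum regrouped by the coordinate \<open>m\<close> of \<open>z\<close>.\<close>
  define H' where "H' z = (\<Sum>m<d. z m * F m z) - \<sigma>\<^sup>2 * l / smooth_norm (u z)" for z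
  have HH': "H (\<lambda>i\<in>{..<d}. \<Sum>k<d. A $$ (i, k) * z k) = H' z" for z
  proof -
    let ?x = "\<lambda>i\<in>{..<d}. \<Sum>k<d. A $$ (i, k) * z k"
    have x: "\<sigma> * ?x i = (\<Sum>k<d. B i k * z k)" if "i < d" for i
      using that by (simp add: B_def sum_distrib_left mult_ac)
    then have ux: "a i + \<sigma> * ?x i = u z i" if "i < d" for i
      using that by (simp add: u_def)
    have s: "smooth_norm (\<lambda>i. a i + \<sigma> * ?x i) = smooth_norm (u z)"
      unfolding smooth_norm_def using ux by simp
    have "(\<Sum>i<d. (a i + \<sigma> * ?x i) * (\<sigma> * ?x i)) = (\<Sum>i<d. u z i * (\<Sum>k<d. B i k * z k))"
      using ux x by (intro sum.cong) auto
    also have "\<dots> = (\<Sum>i<d. \<Sum>k<d. z k * (B i k * u z i))"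
      by (simp add: sum_distrib_left mult_ac)
    also have "\<dots> = (\<Sum>k<d. z k * (\<Sum>i<d. B i k * u z i))"
      by (subst sum.swap) (simp add: sum_distrib_left)
    also have "\<dots> = (\<Sum>k<d. z k * F k z) * smooth_norm (u z)"
      using smooth_norm_pos[of "u z"] by (simp add: F_def sum_distrib_right)
    finally show ?thesis
      unfolding H_def H'_def s using smooth_norm_pos[of "u z"] by simp
  qed
  have tr: "\<sigma>\<^sup>2 * mat_tr C = (\<Sum>m<d. \<Sum>i<d. (B i m)\<^sup>2)"
  proof -
    have "mat_tr C = (\<Sum>i<d. \<Sum>m<d. (A $$ (i, m))\<^sup>2)"
      using A by (simp add: mat_tr_def CA scalar_prod_def atLeast0LessThan power2_eq_square)
    then show ?thesis
      by (subst sum.swap) (simp add: B_def sum_distrib_left power_mult_distrib)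
  qed
  have Cij: "C $$ (i, j) = (\<Sum>m<d. A $$ (i, m) * A $$ (j, m))" if "i < d" "j < d" for i j
    using that A by (simp add: CA scalar_prod_def atLeast0LessThan)
  \<comment> \<open>The left-hand side is
    \<open>|A\<^sup>T x|\<^sup>2 = \<langle>C x, x\<rangle>\<close>.\<close>
  have quad: "(\<Sum>m<d. (\<Sum>i<d. A $$ (i, m) * x i)\<^sup>2) \<le> lambda_max C * (\<Sum>i<d. (x i)\<^sup>2)" for x
  proof -
    have "(\<Sum>m<d. (\<Sum>i<d. A $$ (i, m) * x i)\<^sup>2)
        = (\<Sum>m<d. \<Sum>i<d. \<Sum>j<d. A $$ (i, m) * A $$ (j, m) * x i * x j)"
      by (simp add: power2_eq_square sum_product mult_ac)
    also have "\<dots> = (\<Sum>i<d. \<Sum>m<d. \<Sum>j<d. A $$ (i, m) * A $$ (j, m) * x i * x j)"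
      by (rule sum.swap)
    also have "\<dots> = (\<Sum>i<d. \<Sum>j<d. \<Sum>m<d. A $$ (i, m) * A $$ (j, m) * x i * x j)"
      by (intro sum.cong refl sum.swap)
    also have "\<dots> = (\<Sum>i<d. \<Sum>j<d. C $$ (i, j) * x i * x j)"
      by (simp add: Cij sum_distrib_right)
    also have "\<dots> \<le> lambda_max C * (\<Sum>i<d. (x i)\<^sup>2)"
      using A d by (intro quadratic_form_le_lambda_max)
        (auto simp: CA scalar_prod_def mult.commute)
    finally show ?thesis .
  qed
  \<comment> \<open>Testing \<open>quad\<close> with the all-ones vector. The sign matters because
    \<open>quad\<close> is to be weakened from \<open>|u|\<^sup>2\<close> to the larger square of
    the smoothed norm.\<close>
  have lmax: "lambda_max C \<ge> 0"
  proof -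
    have "0 \<le> (\<Sum>m<d. (\<Sum>i<d. A $$ (i, m) * 1)\<^sup>2)" by (intro sum_nonneg) simp
    with quad[of "\<lambda>_. 1"] have "0 \<le> lambda_max C * real d" by simp
    with d show ?thesis by (simp add: zero_le_mult_iff)
  qed
  \<comment> \<open>After Stein's identity the inequality holds pointwise: \<open>tr\<close> and
    \<open>quad\<close> bring both parts of the divergence over the same denominator, where the gap
    \<open>l\<close> appears.\<close>
  have pw: "\<sigma>\<^sup>2 * l / smooth_norm (u z) \<le> (\<Sum>m<d. F' m z)" for z
  proof -
    let ?s = "smooth_norm (u z)"
    have s: "?s > 0" by (rule smooth_norm_pos)
    have "(\<Sum>m<d. (\<Sum>i<d. B i m * u z i)\<^sup>2) = \<sigma>\<^sup>2 * (\<Sum>m<d. (\<Sum>i<d. A $$ (i, m) * u z i)\<^sup>2)"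
      by (simp add: B_def sum_distrib_left mult.assoc flip: power_mult_distrib)
    also have "\<dots> \<le> \<sigma>\<^sup>2 * (lambda_max C * ?s\<^sup>2)"
      using quad[of "u z"] lmax
      by (intro mult_left_mono) (auto simp: smooth_norm_power2 distrib_left intro: order.trans)
    finally have "(\<Sum>m<d. (\<Sum>i<d. B i m * u z i)\<^sup>2) / ?s ^ 3 \<le> \<sigma>\<^sup>2 * (lambda_max C * ?s\<^sup>2) / ?s ^ 3"
      using s by (intro divide_right_mono) auto
    also have "\<dots> = \<sigma>\<^sup>2 * lambda_max C / ?s"
      using s by (simp add: power2_eq_square power3_eq_cube)
    finally have "(\<Sum>m<d. F' m z) \<ge> \<sigma>\<^sup>2 * mat_tr C / ?s - \<sigma>\<^sup>2 * lambda_max C / ?s"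
      by (simp add: F'_def sum_subtractf tr flip: sum_divide_distrib)
    also have "\<sigma>\<^sup>2 * mat_tr C / ?s - \<sigma>\<^sup>2 * lambda_max C / ?s = \<sigma>\<^sup>2 * (mat_tr C - lambda_max C) / ?s"
      by (simp add: right_diff_distrib diff_divide_distrib)
    also have "\<dots> \<ge> \<sigma>\<^sup>2 * l / ?s"
      using l s by (intro divide_right_mono mult_left_mono) auto
    finally show ?thesis .
  qed
  have intH': "integrable ?N H'"
    unfolding H'_def using stein(1) int_inv
    by (intro Bochner_Integration.integrable_diff Bochner_Integration.integrable_sum) auto
  have "(\<integral>z. H' z \<partial>?N) = (\<integral>z. (\<Sum>m<d. F' m z) - \<sigma>\<^sup>2 * l / smooth_norm (u z) \<partial>?N)"
  proof -
    have "(\<integral>z. H' z \<partial>?N) = (\<Sum>m<d. \<integral>z. z m * F m z \<partial>?N) - (\<integral>z. \<sigma>\<^sup>2 * l / smooth_norm (u z) \<partial>?N)"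
      unfolding H'_def using stein(1) int_inv
      by (subst Bochner_Integration.integral_diff)
        (auto intro!: Bochner_Integration.integrable_sum Bochner_Integration.integral_sum)
    also have "\<dots> = (\<Sum>m<d. \<integral>z. F' m z \<partial>?N) - (\<integral>z. \<sigma>\<^sup>2 * l / smooth_norm (u z) \<partial>?N)"
      by (simp add: stein(3))
    also have "\<dots> = (\<integral>z. (\<Sum>m<d. F' m z) - \<sigma>\<^sup>2 * l / smooth_norm (u z) \<partial>?N)"
      using stein(2) int_inv
      by (subst Bochner_Integration.integral_diff)
        (auto intro!: Bochner_Integration.integrable_sum Bochner_Integration.integral_sum[symmetric])
    finally show ?thesis .
  qed
  also have "\<dots> \<ge> 0"
    using pw by (intro integral_nonneg_AE) auto
  finally have nonneg: "(\<integral>z. H' z \<partial>?N) \<ge> 0" .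
  have mT: "(\<lambda>z. \<lambda>i\<in>{..<d}. \<Sum>k<d. A $$ (i, k) * z k) \<in> ?N \<rightarrow>\<^sub>M (\<Pi>\<^sub>M i\<in>{..<d}. borel)"
    by (intro measurable_restrict) measurable
  have mH: "H \<in> borel_measurable (\<Pi>\<^sub>M i\<in>{..<d}. borel)"
    unfolding H_def by measurable
  show "integrable \<mu> H"
    unfolding mu using intH' by (subst integrable_distr_eq[OF mT mH]) (simp add: HH')
  show "(\<integral>x. H x \<partial>\<mu>) \<ge> 0"
    unfolding mu using nonneg by (subst integral_distr[OF mT mH]) (simp add: HH')
qed

end

section \<open>Conditionally Gaussian vectors\<close>

text \<open>Averaging the conditional probability of an event gives its probability; for a kernel
  that represents these conditional probabilities this is the mixture formula. The exceptional null
  set may depend on \<open>B\<close>, since one event is treated at a time.\<close>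

lemma distr_eq_bind_cond_kernel:
  assumes "prob_space M" and sub: "subalgebra M \<G>"
    and K: "K \<in> \<G> \<rightarrow>\<^sub>M prob_algebra N" and T: "T \<in> M \<rightarrow>\<^sub>M N"
    and cond: "\<And>B. B \<in> sets N \<Longrightarrow>
      AE \<omega> in M. real_cond_exp M \<G> (\<lambda>\<omega>. indicator B (T \<omega>)) \<omega> = measure (K \<omega>) B"
  shows "distr M N T = M \<bind> K"
proof -
  interpret prob_space M by fact
  interpret finite_measure_subalgebra M \<G>
    by standard (rule sub)
  note [measurable] = T
  have K': "K \<in> M \<rightarrow>\<^sub>M prob_algebra N"
    by (rule measurable_from_subalg[OF sub K])
  then have KS: "K \<in> M \<rightarrow>\<^sub>M subprob_algebra N"
    by (rule measurable_prob_algebraD)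
  have pK: "prob_space (K \<omega>)" if "\<omega> \<in> space M" for \<omega>
    using measurable_space[OF K' that] by (simp add: space_prob_algebra)
  show ?thesis
  proof (rule measure_eqI)
    show "sets (distr M N T) = sets (M \<bind> K)"
      using sets_bind_measurable[OF KS not_empty] by simp
    fix B assume "B \<in> sets (distr M N T)"
    then have B[measurable]: "B \<in> sets N" by simp
    let ?E = "real_cond_exp M \<G> (\<lambda>\<omega>. indicator B (T \<omega>))"
    have int: "integrable M (\<lambda>\<omega>. indicator B (T \<omega>) :: real)"
      by (intro integrable_const_bound[where B = 1]) (auto simp: indicator_def)
    have "emeasure (M \<bind> K) B = (\<integral>\<^sup>+\<omega>. emeasure (K \<omega>) B \<partial>M)"
      by (rule emeasure_bind[OF not_empty KS B])
    also have "\<dots> = (\<integral>\<^sup>+\<omega>. ennreal (?E \<omega>) \<partial>M)"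
      using cond[OF B] AE_space
      by (intro nn_integral_cong_AE, eventually_elim)
        (simp add: pK prob_space.finite_measure[THEN finite_measure.emeasure_eq_measure])
    also have "\<dots> = ennreal (\<integral>\<omega>. ?E \<omega> \<partial>M)"
      using cond[OF B] by (intro nn_integral_eq_integral real_cond_exp_int int) auto
    also have "\<dots> = ennreal (\<integral>\<omega>. indicator B (T \<omega>) \<partial>M)"
      by (simp add: real_cond_exp_int[OF int])
    also have "\<dots> = ennreal (\<integral>\<omega>. indicator (T -` B \<inter> space M) \<omega> \<partial>M)"
      by (intro arg_cong[where f = ennreal] Bochner_Integration.integral_cong)
        (auto simp: indicator_def)
    also have "\<dots> = emeasure (distr M N T) B"
      by (simp add: emeasure_distr emeasure_eq_measure)
    finally show "emeasure (distr M N T) B = emeasure (M \<bind> K) B" by simp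
  qed
qed

text \<open>A nonnegative mean under \<open>K \<omega>\<close> says that the negative part
  integrates to at most the positive part. Integrals of nonnegative functions mix without further
  conditions, so this comparison passes to \<open>M \<bind> K\<close>.\<close>

lemma integral_bind_nonneg:
  fixes H :: "'b \<Rightarrow> real"
  assumes K: "K \<in> M \<rightarrow>\<^sub>M subprob_algebra N" and H[measurable]: "H \<in> borel_measurable N"
    and int: "integrable (M \<bind> K) H"
    and nonneg: "AE \<omega> in M. integrable (K \<omega>) H \<and> 0 \<le> (\<integral>x. H x \<partial>K \<omega>)"
  shows "0 \<le> (\<integral>x. H x \<partial>(M \<bind> K))"
proof -
  have "(\<integral>\<^sup>+x. ennreal (- H x) \<partial>(M \<bind> K)) = (\<integral>\<^sup>+\<omega>. (\<integral>\<^sup>+x. ennreal (- H x) \<partial>K \<omega>) \<partial>M)"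
    by (rule nn_integral_bind[OF _ K]) measurable
  also have "\<dots> \<le> (\<integral>\<^sup>+\<omega>. (\<integral>\<^sup>+x. ennreal (H x) \<partial>K \<omega>) \<partial>M)"
  proof (rule nn_integral_mono_AE, use nonneg in eventually_elim)
    case (elim \<omega>)
    then show ?case
      by (auto simp: real_lebesgue_integral_def real_integrable_def)
        (metis ennreal_enn2real ennreal_leI top.not_eq_extremum)
  qed
  also have "\<dots> = (\<integral>\<^sup>+x. ennreal (H x) \<partial>(M \<bind> K))"
    by (rule nn_integral_bind[OF _ K, symmetric]) measurable
  finally show ?thesis
    using int by (auto simp: real_lebesgue_integral_def real_integrable_def top.not_eq_extremum
        intro!: enn2real_mono)
qed

text \<open>AM-GM in the form \<open>2 L m \<le> L\<^sup>2 + m\<^sup>2\<close> replaces Jensen's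
  inequality for the square root: it gives integrability and, with \<open>m\<close> the square root
  of the bound \<open>d \<kappa>\<close> on the second moment, the constant \<open>m\<close>
  itself.\<close>

lemma mean_norm_le:
  fixes X :: "nat \<Rightarrow> 'w \<Rightarrow> real"
  assumes "prob_space M" and d: "d > 0" and \<kappa>: "\<kappa> > 0"
    and X[measurable]: "\<And>i. i < d \<Longrightarrow> X i \<in> borel_measurable M"
    and sq: "\<And>i. i < d \<Longrightarrow> integrable M (\<lambda>\<omega>. (X i \<omega>)\<^sup>2)"
      "\<And>i. i < d \<Longrightarrow> (\<integral>\<omega>. (X i \<omega>)\<^sup>2 \<partial>M) \<le> \<kappa>"
  shows "integrable M (\<lambda>\<omega>. L2_set (\<lambda>i. X i \<omega>) {..<d})" (is ?int)
    and "(\<integral>\<omega>. L2_set (\<lambda>i. X i \<omega>) {..<d} \<partial>M) \<le> sqrt (real d * \<kappa>)"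
proof -
  interpret prob_space M by fact
  let ?m = "sqrt (real d * \<kappa>)"
  have m: "?m > 0" using d \<kappa> by simp
  have AM_GM: "L2_set (\<lambda>i. X i \<omega>) {..<d} \<le> ((\<Sum>i<d. (X i \<omega>)\<^sup>2) / ?m + ?m) / 2" for \<omega>
  proof -
    let ?L = "L2_set (\<lambda>i. X i \<omega>) {..<d}"
    have "0 \<le> (?L - ?m)\<^sup>2" by simp
    moreover have "(x - y)\<^sup>2 = x\<^sup>2 + y * y - 2 * x * y" for x y :: real
      by (simp add: power2_eq_square algebra_simps)
    ultimately have "2 * ?L * ?m \<le> ?L\<^sup>2 + ?m * ?m"
      by (metis diff_ge_0_iff_ge)
    also have "?L\<^sup>2 = (\<Sum>i<d. (X i \<omega>)\<^sup>2)"
      by (simp add: L2_set_def sum_nonneg)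
    finally have "2 * ?L * ?m \<le> (\<Sum>i<d. (X i \<omega>)\<^sup>2) + ?m * ?m" .
    moreover have "x \<le> (q / y + y) / 2" if "2 * x * y \<le> q + y * y" "y > 0" for x y q :: real
      using that by (simp add: field_simps)
    ultimately show ?thesis
      using m by blast
  qed
  have intsum: "integrable M (\<lambda>\<omega>. \<Sum>i<d. (X i \<omega>)\<^sup>2)"
    using sq(1) by (intro Bochner_Integration.integrable_sum) auto
  have valsum: "(\<integral>\<omega>. (\<Sum>i<d. (X i \<omega>)\<^sup>2) \<partial>M) = (\<Sum>i<d. \<integral>\<omega>. (X i \<omega>)\<^sup>2 \<partial>M)"
    using sq(1) by (intro Bochner_Integration.integral_sum) auto
  have intb: "integrable M (\<lambda>\<omega>. ((\<Sum>i<d. (X i \<omega>)\<^sup>2) / ?m + ?m) / 2)"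
    using intsum by (intro integrable_divide Bochner_Integration.integrable_add integrable_const)
  show int: ?int
    unfolding L2_set_def
  proof (rule Bochner_Integration.integrable_bound[OF intb])
    show "AE \<omega> in M. norm (sqrt (\<Sum>i<d. (X i \<omega>)\<^sup>2)) \<le> norm (((\<Sum>i<d. (X i \<omega>)\<^sup>2) / ?m + ?m) / 2)"
      using order.trans[OF AM_GM abs_ge_self] by (intro AE_I2) (simp add: L2_set_def sum_nonneg)
  qed measurable
  have "(\<integral>\<omega>. L2_set (\<lambda>i. X i \<omega>) {..<d} \<partial>M) \<le> (\<integral>\<omega>. ((\<Sum>i<d. (X i \<omega>)\<^sup>2) / ?m + ?m) / 2 \<partial>M)"
    using int intb AM_GM by (intro integral_mono) auto
  also have "\<dots> = ((\<Sum>i<d. \<integral>\<omega>. (X i \<omega>)\<^sup>2 \<partial>M) / ?m + ?m) / 2"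
    using intsum by (simp add: prob_space valsum)
  also have "\<dots> \<le> ((\<Sum>i<d. \<kappa>) / ?m + ?m) / 2"
    using sq m by (intro divide_right_mono add_right_mono sum_mono) auto
  also have "\<dots> = ?m"
    using d \<kappa> by (simp add: real_div_sqrt)
  finally show "(\<integral>\<omega>. L2_set (\<lambda>i. X i \<omega>) {..<d} \<partial>M) \<le> ?m" .
qed

text \<open>The function \<open>H\<close> has nonnegative mean under almost every conditional law,
  hence under their mixture, which is the law of \<open>X\<close>.\<close>

lemma cond_gaussian_smooth_direction_bound:
  fixes X :: "nat \<Rightarrow> 'w \<Rightarrow> real" and a :: "nat \<Rightarrow> real" and \<sigma> :: real
  assumes "prob_space M" and d: "d > 0" and \<epsilon>: "\<epsilon> > 0"
    and sub: "subalgebra M \<G>" and cg: "cond_gaussian M \<G> d X"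
    and gap: "AE \<omega> in M. l \<le> mat_tr (cond_cov M \<G> d X \<omega>) - lambda_max (cond_cov M \<G> d X \<omega>)"
    and int: "\<And>i. i < d \<Longrightarrow> integrable M (X i)"
  defines "u \<equiv> \<lambda>\<omega> i. a i + \<sigma> * X i \<omega>"
  shows "integrable M (\<lambda>\<omega>. (\<Sum>i<d. u \<omega> i * (\<sigma> * X i \<omega>)) / smooth_norm d \<epsilon> (u \<omega>))" (is "integrable M ?F")
    and "integrable M (\<lambda>\<omega>. 1 / smooth_norm d \<epsilon> (u \<omega>))" (is "integrable M ?G")
    and "\<sigma>\<^sup>2 * l * (\<integral>\<omega>. 1 / smooth_norm d \<epsilon> (u \<omega>) \<partial>M)
      \<le> (\<integral>\<omega>. (\<Sum>i<d. u \<omega> i * (\<sigma> * X i \<omega>)) / smooth_norm d \<epsilon> (u \<omega>) \<partial>M)"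
proof -
  interpret prob_space M by fact
  let ?B = "\<Pi>\<^sub>M i\<in>{..<d}. (borel :: real measure)"
  let ?s = "smooth_norm d \<epsilon>"
  note s_pos = smooth_norm_pos[OF \<epsilon>, of d] and s_ge = smooth_norm_ge[OF \<epsilon>, of d]
  have [measurable]: "X i \<in> borel_measurable M" if "i < d" for i
    using int[OF that] by auto
  then have [measurable]: "(\<lambda>\<omega>. u \<omega> i) \<in> borel_measurable M" if "i < d" for i
    using that by (simp add: u_def)
  have [measurable]: "(\<lambda>\<omega>. ?s (u \<omega>)) \<in> borel_measurable M"
    using smooth_norm_measurable[OF \<epsilon>, of d "\<lambda>i \<omega>. u \<omega> i" M] by (simp add: u_def)
  have T[measurable]: "(\<lambda>\<omega>. \<lambda>i\<in>{..<d}. X i \<omega>) \<in> M \<rightarrow>\<^sub>M ?B"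
    by (intro measurable_restrict) auto
  show intF: "integrable M ?F"
  proof (rule Bochner_Integration.integrable_bound)
    show "integrable M (\<lambda>\<omega>. \<Sum>i<d. \<bar>\<sigma> * X i \<omega>\<bar>)"
      using int by auto
    show "AE \<omega> in M. norm (?F \<omega>) \<le> norm (\<Sum>i<d. \<bar>\<sigma> * X i \<omega>\<bar>)"
    proof (rule AE_I2)
      fix \<omega>
      show "norm (?F \<omega>) \<le> norm (\<Sum>i<d. \<bar>\<sigma> * X i \<omega>\<bar>)"
        using abs_linear_form_le_smooth_norm[OF \<epsilon>, of "\<lambda>i. \<sigma> * X i \<omega>" "u \<omega>" d] s_pos[of "u \<omega>"]
        by (simp add: divide_le_eq mult.commute sum_nonneg)
    qed
  qed measurable
  show intG: "integrable M ?G"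
  proof (rule integrable_const_bound[where B = "1 / \<epsilon>"])
    show "AE \<omega> in M. norm (?G \<omega>) \<le> 1 / \<epsilon>"
      using s_pos s_ge \<epsilon> by (intro AE_I2) (simp add: abs_of_pos frac_le)
  qed simp
  define H where "H x = (\<Sum>i<d. (a i + \<sigma> * x i) * (\<sigma> * x i)) / ?s (\<lambda>i. a i + \<sigma> * x i)
      - \<sigma>\<^sup>2 * l / ?s (\<lambda>i. a i + \<sigma> * x i)" for x
  have "(\<lambda>x. ?s (\<lambda>i. a i + \<sigma> * x i)) \<in> borel_measurable ?B"
    by (rule smooth_norm_measurable[OF \<epsilon>]) simp
  then have mH[measurable]: "H \<in> borel_measurable ?B"
    unfolding H_def by measurable
  have HT: "H (\<lambda>i\<in>{..<d}. X i \<omega>) = ?F \<omega> - \<sigma>\<^sup>2 * l * ?G \<omega>" for \<omega>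
    by (simp add: H_def u_def smooth_norm_def[OF \<epsilon>])
  from cg obtain K where K: "K \<in> \<G> \<rightarrow>\<^sub>M prob_algebra ?B"
    and cond: "\<And>B. B \<in> sets ?B \<Longrightarrow> AE \<omega> in M.
           real_cond_exp M \<G> (\<lambda>\<omega>'. indicator B (\<lambda>i\<in>{..<d}. X i \<omega>')) \<omega> = measure (K \<omega>) B"
    and gauss: "AE \<omega> in M. gaussian_law d (cond_cov M \<G> d X \<omega>) (K \<omega>)"
    unfolding cond_gaussian_def by blast
  have law: "distr M ?B (\<lambda>\<omega>. \<lambda>i\<in>{..<d}. X i \<omega>) = M \<bind> K"
    by (rule distr_eq_bind_cond_kernel[OF \<open>prob_space M\<close> sub K T cond])
  have "0 \<le> (\<integral>x. H x \<partial>(M \<bind> K))"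
  proof (rule integral_bind_nonneg[OF _ mH])
    show "K \<in> M \<rightarrow>\<^sub>M subprob_algebra ?B"
      using K by (intro measurable_prob_algebraD measurable_from_subalg[OF sub])
    show "integrable (M \<bind> K) H"
      unfolding law[symmetric]
      using Bochner_Integration.integrable_diff[OF intF integrable_mult_right[OF intG, of "\<sigma>\<^sup>2 * l"]]
      by (subst integrable_distr_eq[OF T mH]) (simp add: HT)
    show "AE \<omega> in M. integrable (K \<omega>) H \<and> 0 \<le> (\<integral>x. H x \<partial>K \<omega>)"
      using gauss gap
    proof eventually_elim
      case (elim \<omega>)
      show ?case
        using gaussian_stein_bound[OF \<epsilon> d elim, where a = a and \<sigma> = \<sigma>]
        unfolding H_def by blast
    qed
  qed
  also have "(\<integral>x. H x \<partial>(M \<bind> K)) = (\<integral>\<omega>. ?F \<omega> - \<sigma>\<^sup>2 * l * ?G \<omega> \<partial>M)"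
    unfolding law[symmetric] by (subst integral_distr[OF T mH]) (simp add: HT)
  also have "\<dots> = (\<integral>\<omega>. ?F \<omega> \<partial>M) - \<sigma>\<^sup>2 * l * (\<integral>\<omega>. ?G \<omega> \<partial>M)"
    using intF intG by (simp del: times_divide_eq_right)
  finally show "\<sigma>\<^sup>2 * l * (\<integral>\<omega>. ?G \<omega> \<partial>M) \<le> (\<integral>\<omega>. ?F \<omega> \<partial>M)"
    by linarith
qed

text \<open>The tangent of the convex function \<open>1 / s\<close> at \<open>m\<close> lies below
  it. Integrated, it gives Jensen's inequality with \<open>m\<close> any upper bound of the
  mean.\<close>

lemma inverse_ge_tangent:
  fixes s m :: real
  assumes "s > 0" "m > 0"
  shows "2 / m - s / m\<^sup>2 \<le> 1 / s"
proof -
  have "1 / s - (2 / m - s / m\<^sup>2) = (m - s)\<^sup>2 / (s * m\<^sup>2)"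
    using assms by (simp add: field_simps power2_eq_square)
  also have "\<dots> \<ge> 0" using assms by simp
  finally show ?thesis by linarith
qed

text \<open>Jensen's inequality is applied with the smoothing still present, and the limit comes
  last. No mean of \<open>1 / |u|\<close> is ever formed: the lower bound is already a number when
  the smoothing is removed.\<close>

lemma cond_gaussian_direction_bound:
  fixes X :: "nat \<Rightarrow> 'w \<Rightarrow> real" and a :: "nat \<Rightarrow> real" and \<sigma> :: real
  assumes "prob_space M" and d: "d > 0"
    and sub: "subalgebra M \<G>" and cg: "cond_gaussian M \<G> d X"
    and gap: "AE \<omega> in M. l \<le> mat_tr (cond_cov M \<G> d X \<omega>) - lambda_max (cond_cov M \<G> d X \<omega>)"
    and l: "l \<ge> 0" and \<sigma>: "\<sigma> \<ge> 0" and \<kappa>: "\<kappa> > 0" and r: "r > 0"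
    and X: "\<And>i. i < d \<Longrightarrow> X i \<in> borel_measurable M"
    and sq: "\<And>i. i < d \<Longrightarrow> integrable M (\<lambda>\<omega>. (X i \<omega>)\<^sup>2)"
      "\<And>i. i < d \<Longrightarrow> (\<integral>\<omega>. (X i \<omega>)\<^sup>2 \<partial>M) \<le> \<kappa>"
    and a: "L2_set a {..<d} \<le> r"
  defines "u \<equiv> \<lambda>\<omega> i. a i + \<sigma> * X i \<omega>"
  shows "integrable M (\<lambda>\<omega>. (\<Sum>i<d. u \<omega> i * (\<sigma> * X i \<omega>)) / L2_set (u \<omega>) {..<d})" (is "integrable M ?F")
    and "\<sigma>\<^sup>2 * l / (r + \<sigma> * sqrt (real d * \<kappa>))
      \<le> (\<integral>\<omega>. (\<Sum>i<d. u \<omega> i * (\<sigma> * X i \<omega>)) / L2_set (u \<omega>) {..<d} \<partial>M)"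
proof -
  interpret prob_space M by fact
  let ?m = "r + \<sigma> * sqrt (real d * \<kappa>)"
  note mean = mean_norm_le[of M d \<kappa> X, OF \<open>prob_space M\<close> d \<kappa> X sq]
  have m: "?m > 0" using r \<sigma> \<kappa> by (intro add_pos_nonneg) auto
  note [measurable] = X
  have u_eq: "a i + \<sigma> * X i \<omega> = u \<omega> i" for i \<omega>
    by (simp add: u_def)
  have int: "integrable M (X i)" if "i < d" for i
    using square_integrable_imp_integrable[OF X sq(1)] that by blast
  define eps where "eps k = 1 / real (Suc k)" for k
  have eps: "eps k > 0" for k by (simp add: eps_def)
  have eps0: "eps \<longlonglongrightarrow> 0"
    unfolding eps_def by (rule LIMSEQ_Suc[OF lim_1_over_n])
  let ?G = "\<lambda>k \<omega>. (\<Sum>i<d. u \<omega> i * (\<sigma> * X i \<omega>)) / smooth_norm d (eps k) (u \<omega>)"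
  have ms: "(\<lambda>\<omega>. smooth_norm d (eps k) (u \<omega>)) \<in> borel_measurable M" for k
    using smooth_norm_measurable[OF eps, of d "\<lambda>i \<omega>. u \<omega> i" M] X by (simp add: u_def)
  have lower: "\<sigma>\<^sup>2 * l / (?m + eps k) \<le> (\<integral>\<omega>. ?G k \<omega> \<partial>M)" for k
  proof -
    let ?s = "\<lambda>\<omega>. smooth_norm d (eps k) (u \<omega>)" and ?M = "?m + eps k"
    have M: "?M > 0" using m eps[of k] by linarith
    \<comment> \<open>Triangle inequalities: the smoothing costs \<open>eps k\<close>, the signal at
      most \<open>r\<close>, and the noise \<open>\<sigma>\<close> times its norm.\<close>
    have s: "?s \<omega> \<le> eps k + r + \<sigma> * L2_set (\<lambda>i. X i \<omega>) {..<d}" for \<omega>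
    proof -
      have "?s \<omega> \<le> sqrt (\<Sum>i<d. (u \<omega> i)\<^sup>2) + sqrt ((eps k)\<^sup>2)"
        unfolding smooth_norm_def[OF eps] by (intro sqrt_add_le_add_sqrt sum_nonneg) auto
      also have "\<dots> = L2_set (u \<omega>) {..<d} + eps k"
        using eps[of k] by (simp add: L2_set_def)
      also have "L2_set (u \<omega>) {..<d} \<le> L2_set a {..<d} + L2_set (\<lambda>i. \<sigma> * X i \<omega>) {..<d}"
        unfolding u_def by (rule L2_set_triangle_ineq)
      also have "L2_set (\<lambda>i. \<sigma> * X i \<omega>) {..<d} = \<sigma> * L2_set (\<lambda>i. X i \<omega>) {..<d}"
        using \<sigma> by (simp add: L2_set_right_distrib)
      finally show ?thesis using a by linarith
    qed
    have ints: "integrable M ?s"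
    proof (rule Bochner_Integration.integrable_bound[OF _ ms])
      show "integrable M (\<lambda>\<omega>. eps k + r + \<sigma> * L2_set (\<lambda>i. X i \<omega>) {..<d})"
        using mean(1) by auto
      show "AE \<omega> in M. norm (?s \<omega>) \<le> norm (eps k + r + \<sigma> * L2_set (\<lambda>i. X i \<omega>) {..<d})"
        using s smooth_norm_pos[OF eps] by (intro AE_I2) (simp add: abs_of_pos order.trans[OF s abs_ge_self])
    qed
    have "(\<integral>\<omega>. ?s \<omega> \<partial>M) \<le> (\<integral>\<omega>. eps k + r + \<sigma> * L2_set (\<lambda>i. X i \<omega>) {..<d} \<partial>M)"
      using ints mean(1) s by (intro integral_mono) auto
    also have "\<dots> = eps k + r + \<sigma> * (\<integral>\<omega>. L2_set (\<lambda>i. X i \<omega>) {..<d} \<partial>M)"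
      using mean(1) by (simp add: prob_space)
    also have "\<dots> \<le> ?M"
      using mult_left_mono[OF mean(2) \<sigma>] by linarith
    finally have Es: "(\<integral>\<omega>. ?s \<omega> \<partial>M) \<le> ?M" .
    have tangent: "2 / ?M - ?s \<omega> / ?M\<^sup>2 \<le> 1 / ?s \<omega>" for \<omega>
      using smooth_norm_pos[OF eps] M by (rule inverse_ge_tangent)
    note stein = cond_gaussian_smooth_direction_bound[OF \<open>prob_space M\<close> d eps[of k] sub cg gap int,
        where a = a and \<sigma> = \<sigma>, unfolded u_eq]
    have "1 / x = 2 / x - x / x\<^sup>2" if "x > 0" for x :: real
      using that by (simp add: power2_eq_square field_simps)
    then have "1 / ?M = 2 / ?M - ?M / ?M\<^sup>2"
      using M by blast
    also have "\<dots> \<le> 2 / ?M - (\<integral>\<omega>. ?s \<omega> \<partial>M) / ?M\<^sup>2"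
      using Es M by (intro diff_left_mono divide_right_mono) auto
    also have "\<dots> = (\<integral>\<omega>. 2 / ?M - ?s \<omega> / ?M\<^sup>2 \<partial>M)"
      using ints by (simp add: prob_space)
    also have "\<dots> \<le> (\<integral>\<omega>. 1 / ?s \<omega> \<partial>M)"
      using ints stein(2) tangent by (intro integral_mono) auto
    finally have "\<sigma>\<^sup>2 * l * (1 / ?M) \<le> \<sigma>\<^sup>2 * l * (\<integral>\<omega>. 1 / ?s \<omega> \<partial>M)"
      using l by (intro mult_left_mono) auto
    with stein(3) show ?thesis by simp
  qed
  \<comment> \<open>At \<open>u \<omega> = 0\<close> the numerator vanishes, so the quotients are 0
    for every \<open>k\<close>, and so is the limit with its division by zero; convergence holds
    everywhere.\<close>
  have lim: "(\<lambda>k. ?G k \<omega>) \<longlonglongrightarrow> ?F \<omega>" for \<omega>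
  proof (cases "L2_set (u \<omega>) {..<d} = 0")
    case True
    then have "u \<omega> i = 0" if "i < d" for i
      using that by (simp add: L2_set_eq_0_iff)
    then show ?thesis by simp
  next
    case False
    have "(\<lambda>k. smooth_norm d (eps k) (u \<omega>)) \<longlonglongrightarrow> sqrt ((\<Sum>i<d. (u \<omega> i)\<^sup>2) + 0\<^sup>2)"
      unfolding smooth_norm_def[OF eps] by (intro tendsto_intros eps0)
    with False show ?thesis
      by (intro tendsto_divide tendsto_const) (simp_all add: L2_set_def)
  qed
  have dom: "integrable M (\<lambda>\<omega>. \<Sum>i<d. \<bar>\<sigma> * X i \<omega>\<bar>)"
    using int by auto
  have bound: "norm (?G k \<omega>) \<le> (\<Sum>i<d. \<bar>\<sigma> * X i \<omega>\<bar>)" for k \<omega>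
    using abs_linear_form_le_smooth_norm[OF eps, of "\<lambda>i. \<sigma> * X i \<omega>" "u \<omega>" d k]
      smooth_norm_pos[OF eps, of d k "u \<omega>"]
    by (simp add: divide_le_eq mult.commute)
  have mF: "?F \<in> borel_measurable M"
    unfolding L2_set_def u_def by measurable
  have mG: "?G k \<in> borel_measurable M" for k
    using ms[of k] unfolding u_def by measurable
  note dc = mF mG dom AE_I2[OF lim] AE_I2[OF bound]
  show "integrable M ?F"
    by (rule integrable_dominated_convergence[OF dc])
  have "(\<lambda>k. \<integral>\<omega>. ?G k \<omega> \<partial>M) \<longlonglongrightarrow> (\<integral>\<omega>. ?F \<omega> \<partial>M)"
    by (rule integral_dominated_convergence[OF dc])
  moreover have "(\<lambda>k. \<sigma>\<^sup>2 * l / (?m + eps k)) \<longlonglongrightarrow> \<sigma>\<^sup>2 * l / (?m + 0)"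
    using m by (intro tendsto_intros eps0) auto
  ultimately show "\<sigma>\<^sup>2 * l / ?m \<le> (\<integral>\<omega>. ?F \<omega> \<partial>M)"
    using LIMSEQ_le lower by (metis (no_types, lifting) add.right_neutral)
qed

section \<open>Discrete Fourier coefficients\<close>

definition cell :: "nat \<Rightarrow> nat \<Rightarrow> real set" where
  "cell p k = {grid p (k - 1)<..grid p k}"

definition step_fun :: "nat \<Rightarrow> nat \<Rightarrow> (nat \<Rightarrow> real) \<Rightarrow> real \<Rightarrow> real" where
  "step_fun p m c t = (\<Sum>k=1..m. c k * indicator (cell p k) t)"

lemma psi_eq_step_fun: "psi n p \<phi> j = step_fun p (n * p) (\<lambda>k. \<phi> j (grid p k))"
  by (simp add: psi_def step_fun_def cell_def fun_eq_iff)

lemma grid_mono: "k \<le> l \<Longrightarrow> grid p k \<le> grid p l"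
  by (simp add: grid_def divide_right_mono)

lemma grid_nonneg: "0 \<le> grid p k"
  by (simp add: grid_def)

lemma cell_measurable [measurable]: "cell p k \<in> sets borel"
  by (simp add: cell_def)

lemma cell_disjoint:
  assumes "k \<noteq> l" "1 \<le> k" "1 \<le> l" "t \<in> cell p k"
  shows "t \<notin> cell p l"
proof (cases "k < l")
  case True
  then have "grid p k \<le> grid p (l - 1)" by (intro grid_mono) simp
  with assms show ?thesis by (auto simp: cell_def)
next
  case False
  then have "grid p l \<le> grid p (k - 1)" using assms by (intro grid_mono) simp
  with assms show ?thesis by (auto simp: cell_def)
qed

lemma measure_cell:
  assumes "1 \<le> k" "p > 0"
  shows "measure lborel (cell p k) = 1 / real p"
proof -
  have "grid p k - grid p (k - 1) = 1 / real p"
    using assms by (simp add: grid_def of_nat_diff diff_divide_distrib)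
  moreover have "grid p (k - 1) \<le> grid p k" by (rule grid_mono) simp
  ultimately show ?thesis by (simp add: cell_def)
qed

lemma cell_subset:
  assumes "k \<le> n * p" "p > 0"
  shows "cell p k \<subseteq> {0..real n}"
proof -
  have "grid p k \<le> grid p (n * p)" using assms by (intro grid_mono)
  moreover have "grid p (n * p) = real n" using assms by (simp add: grid_def)
  ultimately show ?thesis
    using grid_nonneg[of p "k - 1"] by (auto simp: cell_def)
qed

lemma emeasure_cell_finite: "emeasure lborel (cell p k) < \<infinity>"
proof -
  have "grid p (k - 1) \<le> grid p k" by (rule grid_mono) simp
  then show ?thesis by (simp add: cell_def)
qed

text \<open>The cells are disjoint, so only the diagonal of the double sum survives. Squares of step
  functions are again step functions, which reduces L2 computations to measures of cells.\<close>

lemma step_fun_mult: "step_fun p m b t * step_fun p m c t = step_fun p m (\<lambda>k. b k * c k) t"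
proof -
  have "step_fun p m b t * step_fun p m c t
      = (\<Sum>k=1..m. \<Sum>l=1..m. b k * c l * (indicator (cell p k) t * indicator (cell p l) t))"
    unfolding step_fun_def sum_product by (simp only: mult_ac)
  also have "\<dots> = (\<Sum>k=1..m. \<Sum>l=1..m. if l = k then b k * c k * indicator (cell p k) t else 0)"
    using cell_disjoint[of _ _ t p] by (intro sum.cong refl) (auto simp: indicator_def)
  also have "\<dots> = step_fun p m (\<lambda>k. b k * c k) t"
    by (simp add: step_fun_def)
  finally show ?thesis .
qed

lemma sum_step_fun:
  "(\<Sum>j\<in>A. a j * step_fun p m (c j) t) = step_fun p m (\<lambda>k. \<Sum>j\<in>A. a j * c j k) t"
  unfolding step_fun_def sum_distrib_left sum_distrib_right
  by (subst sum.swap) (simp only: mult.assoc)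

text \<open>The factor 1 matches the linear combinations \<open>a * f t + b * g t\<close> in
  \<open>stochastic_integral\<close>.\<close>

lemma step_fun_Suc:
  "step_fun p (Suc m) c t = 1 * step_fun p m c t + c (Suc m) * indicator (cell p (Suc m)) t"
  by (simp add: step_fun_def)

lemma step_fun_measurable [measurable]: "step_fun p m c \<in> borel_measurable borel"
  unfolding step_fun_def by measurable

lemma integrable_step_fun: "integrable lborel (step_fun p m c)"
  unfolding step_fun_def using emeasure_cell_finite
  by (intro Bochner_Integration.integrable_sum integrable_mult_right integrable_real_indicator) auto

lemma L2_on_step_fun: "L2_on a b (step_fun p m c)"
proof -
  have "integrable lborel (\<lambda>t. (step_fun p m c t)\<^sup>2)"
    by (simp add: power2_eq_square step_fun_mult integrable_step_fun)
  then have "integrable lborel (\<lambda>t. indicator {a..b} t *\<^sub>R (step_fun p m c t)\<^sup>2)"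
    by (intro integrable_mult_indicator) auto
  then show ?thesis
    unfolding L2_on_def set_borel_measurable_def set_integrable_def by auto
qed

lemma L2_on_indicator_cell: "L2_on a b (indicator (cell p k))"
proof -
  have "integrable lborel (indicator (cell p k) :: real \<Rightarrow> real)"
    using emeasure_cell_finite by (intro integrable_real_indicator) auto
  moreover have "(\<lambda>t. (indicator (cell p k) t :: real)\<^sup>2) = indicator (cell p k)"
    by (auto simp: indicator_def)
  ultimately have "integrable lborel (\<lambda>t. (indicator (cell p k) t :: real)\<^sup>2)"
    by simp
  then have "integrable lborel (\<lambda>t. indicator {a..b} t *\<^sub>R (indicator (cell p k) t :: real)\<^sup>2)"
    by (intro integrable_mult_indicator) auto
  then show ?thesis
    unfolding L2_on_def set_borel_measurable_def set_integrable_def by auto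
qed

lemma integral_step_fun_square:
  assumes "p > 0"
  shows "set_lebesgue_integral lborel {0..real n} (\<lambda>t. (step_fun p (n * p) c t)\<^sup>2)
    = (\<Sum>k=1..n * p. (c k)\<^sup>2) / real p"
proof -
  have "(\<lambda>t. indicator {0..real n} t *\<^sub>R (step_fun p (n * p) c t)\<^sup>2)
      = (\<lambda>t. \<Sum>k=1..n * p. (c k)\<^sup>2 * indicator (cell p k) t)"
  proof
    fix t
    have "indicator {0..real n} t * (x * indicator (cell p k) t) = x * (indicator (cell p k) t :: real)"
      if "k \<in> {1..n * p}" for k x
      using cell_subset[of k n p] that assms by (auto simp: indicator_def)
    then have "(\<Sum>k=1..n * p. indicator {0..real n} t * ((c k * c k) * indicator (cell p k) t))
        = (\<Sum>k=1..n * p. (c k)\<^sup>2 * indicator (cell p k) t)"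
      by (intro sum.cong refl) (simp only: power2_eq_square)
    moreover have "(step_fun p (n * p) c t)\<^sup>2 = (\<Sum>k=1..n * p. (c k * c k) * indicator (cell p k) t)"
      unfolding power2_eq_square step_fun_mult by (simp only: step_fun_def)
    ultimately show "indicator {0..real n} t *\<^sub>R (step_fun p (n * p) c t)\<^sup>2
        = (\<Sum>k=1..n * p. (c k)\<^sup>2 * indicator (cell p k) t)"
      by (simp only: sum_distrib_left real_scaleR_def)
  qed
  then have "set_lebesgue_integral lborel {0..real n} (\<lambda>t. (step_fun p (n * p) c t)\<^sup>2)
      = (\<integral>t. (\<Sum>k=1..n * p. (c k)\<^sup>2 * indicator (cell p k) t) \<partial>lborel)"
    by (simp only: set_lebesgue_integral_def)
  also have "\<dots> = (\<Sum>k=1..n * p. \<integral>t. (c k)\<^sup>2 * indicator (cell p k) t \<partial>lborel)"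
    using emeasure_cell_finite
    by (intro Bochner_Integration.integral_sum integrable_mult_right integrable_real_indicator) auto
  also have "\<dots> = (\<Sum>k=1..n * p. (c k)\<^sup>2 / real p)"
    using measure_cell[OF _ assms] by (intro sum.cong refl) auto
  finally show ?thesis
    by (simp only: sum_divide_distrib)
qed

text \<open>On [0,1] only the first \<open>p\<close> cells contribute.\<close>

lemma integral_step_fun_diff_square:
  assumes p: "p > 0" and n: "n > 0" and S: "continuous_on UNIV S"
  shows "set_lebesgue_integral lborel {0..1} (\<lambda>t. (step_fun p (n * p) c t - S t)\<^sup>2)
    = (\<Sum>k=1..p. (c k)\<^sup>2) / real p
      - 2 * (\<Sum>k=1..p. c k * set_lebesgue_integral lborel (cell p k) S)
      + set_lebesgue_integral lborel {0..1} (\<lambda>t. (S t)\<^sup>2)"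
proof -
  have restr: "step_fun p (n * p) c t = step_fun p (1 * p) c t" if "t \<in> {0..1}" for t
  proof -
    have "t \<notin> cell p k" if "k \<in> {1..n * p} - {1..p}" for k
    proof -
      have "grid p p \<le> grid p (k - 1)" using that by (intro grid_mono) auto
      then show ?thesis
        using \<open>t \<in> {0..1}\<close> p by (auto simp: cell_def grid_def[of p p])
    qed
    then show ?thesis
      unfolding step_fun_def using n by (intro sum.mono_neutral_right) auto
  qed
  have [measurable]: "S \<in> borel_measurable borel"
    using S by (rule borel_measurable_continuous_onI)
  have int_cont: "set_integrable lborel {0..1} f" if "continuous_on UNIV f" for f :: "real \<Rightarrow> real"
    using that by (intro borel_integrable_compact[unfolded set_integrable_def[symmetric]]
        continuous_on_subset[OF that]) auto
  have intS: "set_integrable lborel {0..1} S" and intS2: "set_integrable lborel {0..1} (\<lambda>t. (S t)\<^sup>2)"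
    using S by (auto intro!: int_cont continuous_intros)
  have intc: "set_integrable lborel (cell p k) S" if "k \<in> {1..p}" for k
    using intS by (rule set_integrable_subset) (use cell_subset[of k 1 p] that p in auto)
  let ?f = "step_fun p (1 * p) c"
  have int1: "set_integrable lborel {0..1} (\<lambda>t. (?f t)\<^sup>2)"
    using L2_on_step_fun[of 0 1 p "1 * p" c] by (simp add: L2_on_def)
  \<comment> \<open>Each of the first \<open>p\<close> cells lies in [0,1], so the indicator of
    [0,1] is absorbed and the cross term splits into integrals of \<open>S\<close> over
    cells.\<close>
  have eq2: "(\<lambda>t. indicator {0..1} t *\<^sub>R (?f t * S t))
      = (\<lambda>t. \<Sum>k=1..p. c k * (indicator (cell p k) t *\<^sub>R S t))"
  proof
    fix t
    have "indicator {0..1} t * (c k * indicator (cell p k) t * S t) = c k * (indicator (cell p k) t * S t)"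
      if "k \<in> {1..p}" for k
      using cell_subset[of k 1 p] that p by (auto simp: indicator_def)
    then show "indicator {0..1} t *\<^sub>R (?f t * S t) = (\<Sum>k=1..p. c k * (indicator (cell p k) t *\<^sub>R S t))"
      unfolding step_fun_def sum_distrib_left sum_distrib_right real_scaleR_def mult_1
      by (rule sum.cong[OF refl])
  qed
  have int2: "set_integrable lborel {0..1} (\<lambda>t. ?f t * S t)"
    unfolding set_integrable_def eq2 using intc
    by (intro Bochner_Integration.integrable_sum integrable_mult_right) (auto simp: set_integrable_def)
  have val2: "set_lebesgue_integral lborel {0..1} (\<lambda>t. ?f t * S t)
      = (\<Sum>k=1..p. c k * set_lebesgue_integral lborel (cell p k) S)"
    unfolding set_lebesgue_integral_def eq2 using intc
    by (subst Bochner_Integration.integral_sum) (auto simp: set_integrable_def)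
  have "set_lebesgue_integral lborel {0..1} (\<lambda>t. (step_fun p (n * p) c t - S t)\<^sup>2)
      = set_lebesgue_integral lborel {0..1} (\<lambda>t. (?f t)\<^sup>2 - 2 * (?f t * S t) + (S t)\<^sup>2)"
    using restr by (intro set_lebesgue_integral_cong) (auto simp: power2_diff algebra_simps)
  also have "\<dots> = set_lebesgue_integral lborel {0..1} (\<lambda>t. (?f t)\<^sup>2)
      - 2 * set_lebesgue_integral lborel {0..1} (\<lambda>t. ?f t * S t)
      + set_lebesgue_integral lborel {0..1} (\<lambda>t. (S t)\<^sup>2)"
    using int1 int2 intS2 by (simp add: set_integral_add set_integral_diff set_integral_mult_right)
  finally show ?thesis
    using integral_step_fun_square[OF p, of 1 c] val2 by simp
qed

text \<open>The inner product of \<open>S\<close> and \<open>psi n p \<phi> j\<close> in L2[0,1],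
  computed cell by cell; only the \<open>p\<close> cells of [0,1] enter, so \<open>n\<close> does
  not.\<close>

definition theta_bar :: "nat \<Rightarrow> (nat \<Rightarrow> real \<Rightarrow> real) \<Rightarrow> (real \<Rightarrow> real) \<Rightarrow> nat \<Rightarrow> real" where
  "theta_bar p \<phi> S j = (\<Sum>k=1..p. \<phi> j (grid p k) * set_lebesgue_integral lborel (cell p k) S)"

lemma L2_norm_unit_power2: "(L2_norm_unit f)\<^sup>2 = set_lebesgue_integral lborel {0..1} (\<lambda>t. (f t)\<^sup>2)"
  by (simp add: L2_norm_unit_def set_lebesgue_integral_def)

text \<open>Orthonormality on the grid makes the step functions \<open>psi\<close> orthonormal in
  L2[0,1]. As \<open>S\<close> need not lie in their span, its full norm remains; it cancels when
  two estimators are compared.\<close>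

lemma L2_error_expansion:
  assumes p: "p > 0" and n: "n > 0" and S: "continuous_on UNIV S"
    and basis: "discrete_basis p \<phi> \<phi>\<^sub>s"
  shows "(L2_norm_unit (\<lambda>t. (\<Sum>j=1..p. a j * psi n p \<phi> j t) - S t))\<^sup>2
    = (\<Sum>j=1..p. (a j)\<^sup>2) - 2 * (\<Sum>j=1..p. a j * theta_bar p \<phi> S j) + (L2_norm_unit S)\<^sup>2"
proof -
  let ?c = "\<lambda>k. \<Sum>j=1..p. a j * \<phi> j (grid p k)"
  have orth: "(\<Sum>k=1..p. \<phi> i (grid p k) * \<phi> j (grid p k)) / real p = (if i = j then 1 else 0)"
    if "i \<in> {1..p}" "j \<in> {1..p}" for i j
    using basis that by (auto simp: discrete_basis_def)
  have "(\<Sum>k=1..p. (?c k)\<^sup>2) / real p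
      = (\<Sum>k=1..p. \<Sum>i=1..p. \<Sum>j=1..p. a i * a j * (\<phi> i (grid p k) * \<phi> j (grid p k))) / real p"
    by (simp add: power2_eq_square sum_product mult_ac)
  also have "\<dots> = (\<Sum>i=1..p. \<Sum>j=1..p. \<Sum>k=1..p. a i * a j * (\<phi> i (grid p k) * \<phi> j (grid p k))) / real p"
    by (subst sum.swap, subst (2) sum.swap) simp
  also have "\<dots> = (\<Sum>i=1..p. \<Sum>j=1..p. a i * a j
      * ((\<Sum>k=1..p. \<phi> i (grid p k) * \<phi> j (grid p k)) / real p))"
    by (simp add: sum_divide_distrib sum_distrib_left)
  also have "\<dots> = (\<Sum>i=1..p. \<Sum>j=1..p. if i = j then a i * a j else 0)"
    by (intro sum.cong refl, subst orth) auto
  also have "\<dots> = (\<Sum>j=1..p. (a j)\<^sup>2)"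
    by (simp add: power2_eq_square)
  finally have sq: "(\<Sum>k=1..p. (?c k)\<^sup>2) / real p = (\<Sum>j=1..p. (a j)\<^sup>2)" .
  have lin: "(\<Sum>k=1..p. ?c k * set_lebesgue_integral lborel (cell p k) S)
      = (\<Sum>j=1..p. a j * theta_bar p \<phi> S j)"
    by (simp add: theta_bar_def sum_distrib_left sum_distrib_right mult.assoc) (rule sum.swap)
  show ?thesis
    unfolding L2_norm_unit_power2 psi_eq_step_fun sum_step_fun
    by (simp only: integral_step_fun_diff_square[OF p n S] sq lin)
qed

text \<open>Nonnegativity of the error of the projection, whose coefficients are
  \<open>theta_bar p \<phi> S\<close>.\<close>

lemma theta_bar_bessel:
  assumes p: "p > 0" and S: "continuous_on UNIV S" and basis: "discrete_basis p \<phi> \<phi>\<^sub>s"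
    and d: "d \<le> p"
  shows "L2_set (\<lambda>i. theta_bar p \<phi> S (Suc i)) {..<d} \<le> L2_norm_unit S"
proof -
  \<comment> \<open>The number of periods is set to 1, as this inequality does not involve
    it.\<close>
  have "0 \<le> (L2_norm_unit S)\<^sup>2 - (\<Sum>j=1..p. (theta_bar p \<phi> S j)\<^sup>2)"
    using L2_error_expansion[where n = 1 and a = "theta_bar p \<phi> S", OF p _ S basis]
      zero_le_power2[of "L2_norm_unit (\<lambda>t. (\<Sum>j=1..p. theta_bar p \<phi> S j * psi 1 p \<phi> j t) - S t)"]
    by (simp add: power2_eq_square)
  moreover have "(\<Sum>i<d. (theta_bar p \<phi> S (Suc i))\<^sup>2) = (\<Sum>j=1..d. (theta_bar p \<phi> S j)\<^sup>2)"
    by (simp add: sum.atLeast1_atMost_eq)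
  moreover have "(\<Sum>j=1..d. (theta_bar p \<phi> S j)\<^sup>2) \<le> (\<Sum>j=1..p. (theta_bar p \<phi> S j)\<^sup>2)"
    using d by (intro sum_mono2) auto
  ultimately show ?thesis
    unfolding L2_set_def
    by (intro real_le_lsqrt) (auto simp: L2_norm_unit_def set_lebesgue_integral_def sum_nonneg)
qed

section \<open>From one period to \<open>n\<close> periods: the empirical coefficients\<close>

lemma sum_periodic:
  fixes f :: "nat \<Rightarrow> real"
  assumes "\<And>l. l \<ge> 1 \<Longrightarrow> f (l + p) = f l"
  shows "(\<Sum>l=1..n * p. f l) = real n * (\<Sum>l=1..p. f l)"
proof (induction n)
  case (Suc n)
  have shift: "f (l + n * p) = f l" if "l \<ge> 1" for l
  proof (induction n)
    case (Suc n)
    then show ?case using assms[of "l + n * p"] that by (simp add: ac_simps)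
  qed simp
  have "(\<Sum>l=1..Suc n * p. f l) = (\<Sum>l=1..n * p. f l) + (\<Sum>l=n * p + 1..n * p + p. f l)"
    by (subst sum.ub_add_nat[symmetric]) (auto simp: add.commute)
  also have "(\<Sum>l=n * p + 1..n * p + p. f l) = (\<Sum>l=1..p. f (l + n * p))"
    by (subst sum.shift_bounds_cl_nat_ivl[symmetric]) (simp add: add.commute)
  also have "\<dots> = (\<Sum>l=1..p. f l)"
    by (intro sum.cong refl shift) simp
  finally show ?case
    using Suc by (simp add: algebra_simps)
qed simp

lemma grid_add_period: "p > 0 \<Longrightarrow> grid p (k + p) = grid p k + 1"
  by (simp add: grid_def add_divide_distrib)

lemma cell_integral_periodic:
  assumes p: "p > 0" and per: "periodic1 S" and k: "k \<ge> 1"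
  shows "set_lebesgue_integral lborel (cell p (k + p)) S = set_lebesgue_integral lborel (cell p k) S"
proof -
  \<comment> \<open>Truncated subtraction: for \<open>k = 0\<close> the left end of the cell would
    not shift by a full period.\<close>
  have "k + p - 1 = (k - 1) + p" using k by simp
  then have ind: "indicator (cell p (k + p)) (1 + x) = (indicator (cell p k) x :: real)" for x
    by (simp add: cell_def grid_add_period[OF p] indicator_def)
  have S: "S (1 + x) = S x" for x
    using per by (metis add.commute periodic1_def)
  show ?thesis
    unfolding set_lebesgue_integral_def
    by (subst lborel_integral_real_affine[of 1 _ 1]) (simp_all add: ind S)
qed

text \<open>\<open>y0\<close> and \<open>\<xi> 0\<close> cancel in the increments. The drift
  contributes the integrals of \<open>S\<close> over the cells; by periodicity their weighted sum
  over \<open>n\<close> periods is \<open>n\<close> times that over one, and the factor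
  \<open>1 / n\<close> in \<open>theta_hat\<close> removes this \<open>n\<close>.\<close>

lemma theta_hat_observation:
  assumes p: "p > 0" and n: "n > 0" and S: "continuous_on UNIV S" and per: "periodic1 S"
    and phi: "periodic1 (\<phi> j)"
  shows "theta_hat n p \<phi> (observation y0 \<xi> S \<omega>) j = theta_bar p \<phi> S j
    + (\<Sum>l=1..n * p. \<phi> j (grid p l) * (\<xi> (grid p l) \<omega> - \<xi> (grid p (l - 1)) \<omega>)) / real n"
proof -
  let ?T = "\<lambda>l. set_lebesgue_integral lborel (cell p l) S"
  have int: "set_integrable lborel {a..b} S" for a b
    by (intro borel_integrable_compact[unfolded set_integrable_def[symmetric]]
        continuous_on_subset[OF S]) auto
  have incr: "set_lebesgue_integral lborel {0..grid p l} S
      = set_lebesgue_integral lborel {0..grid p (l - 1)} S + ?T l" for l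
  proof -
    have le: "grid p (l - 1) \<le> grid p l" by (rule grid_mono) simp
    have "{0..grid p l} = {0..grid p (l - 1)} \<union> cell p l"
      using le grid_nonneg[of p "l - 1"] by (auto simp: cell_def)
    moreover have "set_integrable lborel (cell p l) S"
      by (rule set_integrable_subset[OF int[of "grid p (l - 1)" "grid p l"]]) (auto simp: cell_def)
    moreover have "{0..grid p (l - 1)} \<inter> cell p l = {}"
      by (auto simp: cell_def)
    ultimately show ?thesis
      by (simp only: set_integral_Un[OF _ int])
  qed
  have "(\<Sum>l=1..n * p. \<phi> j (grid p l) * ?T l) = real n * theta_bar p \<phi> S j"
    unfolding theta_bar_def
  proof (rule sum_periodic)
    fix l :: nat assume "l \<ge> 1"
    then show "\<phi> j (grid p (l + p)) * ?T (l + p) = \<phi> j (grid p l) * ?T l"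
      using phi by (simp add: cell_integral_periodic[OF p per] grid_add_period[OF p] periodic1_def)
  qed
  moreover have "theta_hat n p \<phi> (observation y0 \<xi> S \<omega>) j
      = ((\<Sum>l=1..n * p. \<phi> j (grid p l) * ?T l)
        + (\<Sum>l=1..n * p. \<phi> j (grid p l) * (\<xi> (grid p l) \<omega> - \<xi> (grid p (l - 1)) \<omega>))) / real n"
  proof -
    have "\<phi> j (grid p l) * (observation y0 \<xi> S \<omega> (grid p l) - observation y0 \<xi> S \<omega> (grid p (l - 1)))
        = \<phi> j (grid p l) * ?T l + \<phi> j (grid p l) * (\<xi> (grid p l) \<omega> - \<xi> (grid p (l - 1)) \<omega>)" for l
      unfolding observation_def incr[of l] by (simp add: algebra_simps)
    then show ?thesis
      by (simp add: theta_hat_def sum.distrib)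
  qed
  ultimately show ?thesis
    using n by (simp add: add_divide_distrib)
qed

text \<open>For step functions linearity and the value on intervals determine the integral. Both
  hold up to null sets that depend on the functions, and the induction over the cells collects
  finitely many of them.\<close>

lemma stochastic_integral_step_fun:
  assumes J: "stochastic_integral M (real n) \<xi> J" and p: "p > 0" and m: "m \<le> n * p"
  shows "AE \<omega> in M. J (step_fun p m c) \<omega>
    = (\<Sum>l=1..m. c l * (\<xi> (grid p l) \<omega> - \<xi> (grid p (l - 1)) \<omega>))"
proof -
  from J have lin: "\<forall>f g a b. L2_on 0 (real n) f \<longrightarrow> L2_on 0 (real n) g \<longrightarrow>
        (AE \<omega> in M. J (\<lambda>t. a * f t + b * g t) \<omega> = a * J f \<omega> + b * J g \<omega>)"
    unfolding stochastic_integral_def by (elim conjE)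
  from J have incr: "\<forall>s t. 0 \<le> s \<and> s \<le> t \<and> t \<le> real n \<longrightarrow>
        (AE \<omega> in M. J (indicator {s<..t}) \<omega> = \<xi> t \<omega> - \<xi> s \<omega>)"
    unfolding stochastic_integral_def by (elim conjE)
  show ?thesis
    using m
  proof (induction m)
    case 0
    \<comment> \<open>The zero function is a combination of L2 functions with coefficients 0, so
      linearity makes its integral vanish.\<close>
    have "AE \<omega> in M. J (\<lambda>t. 0 * step_fun p 0 c t + 0 * step_fun p 0 c t) \<omega>
        = 0 * J (step_fun p 0 c) \<omega> + 0 * J (step_fun p 0 c) \<omega>"
      by (rule lin[rule_format]) (rule L2_on_step_fun)+
    moreover have "step_fun p 0 c = (\<lambda>t. 0)"
      by (simp add: step_fun_def fun_eq_iff)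
    ultimately show ?case by simp
  next
    case (Suc m)
    have "AE \<omega> in M. J (\<lambda>t. 1 * step_fun p m c t + c (Suc m) * indicator (cell p (Suc m)) t) \<omega>
        = 1 * J (step_fun p m c) \<omega> + c (Suc m) * J (indicator (cell p (Suc m))) \<omega>"
      by (rule lin[rule_format]) (rule L2_on_step_fun L2_on_indicator_cell)+
    moreover have "(\<lambda>t. 1 * step_fun p m c t + c (Suc m) * indicator (cell p (Suc m)) t)
        = step_fun p (Suc m) c"
      by (rule ext) (rule step_fun_Suc[symmetric])
    ultimately have "AE \<omega> in M. J (step_fun p (Suc m) c) \<omega>
        = J (step_fun p m c) \<omega> + c (Suc m) * J (indicator (cell p (Suc m))) \<omega>"
      by simp
    moreover have "AE \<omega> in M. J (indicator (cell p (Suc m))) \<omega> = \<xi> (grid p (Suc m)) \<omega> - \<xi> (grid p m) \<omega>"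
    proof -
      have "grid p (Suc m) \<le> grid p (n * p)" using Suc.prems by (intro grid_mono)
      then have "grid p (Suc m) \<le> real n" using p by (simp add: grid_def)
      moreover have "0 \<le> grid p m" "grid p m \<le> grid p (Suc m)"
        by (rule grid_nonneg, rule grid_mono, simp)
      ultimately have "AE \<omega> in M. J (indicator {grid p m<..grid p (Suc m)}) \<omega>
          = \<xi> (grid p (Suc m)) \<omega> - \<xi> (grid p m) \<omega>"
        by (intro incr[rule_format] conjI)
      then show ?thesis
        by (simp add: cell_def)
    qed
    moreover have "AE \<omega> in M. J (step_fun p m c) \<omega>
        = (\<Sum>l=1..m. c l * (\<xi> (grid p l) \<omega> - \<xi> (grid p (l - 1)) \<omega>))"
      using Suc by simp
    ultimately show ?case
      by eventually_elim simp
  qed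
qed

lemma theta_hat_eq_theta_bar_plus_noise:
  assumes J: "stochastic_integral M (real n) \<xi> J" and p: "p > 0" and n: "n > 0"
    and S: "continuous_on UNIV S" and per: "periodic1 S" and phi: "periodic1 (\<phi> j)"
  shows "AE \<omega> in M. theta_hat n p \<phi> (observation y0 \<xi> S \<omega>) j
    = theta_bar p \<phi> S j + 1 / sqrt (real n) * xi_coef n p \<phi> J j \<omega>"
  using stochastic_integral_step_fun[OF J p order_refl, of "\<lambda>k. \<phi> j (grid p k)"]
proof eventually_elim
  case (elim \<omega>)
  then show ?case
    using n unfolding theta_hat_observation[where \<phi> = \<phi> and j = j, OF p n S per phi] xi_coef_def psi_eq_step_fun elim
    by simp
qed

text \<open>\<open>psi\<close> has squared norm \<open>n\<close> on [0,n], namely 1 on each of the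
  \<open>n\<close> periods by the normalization on the grid; division by \<open>sqrt n\<close>
  leaves the constant \<open>\<kappa> Q\<close> alone.\<close>

lemma xi_coef_second_moment:
  assumes model: "noise_model n \<Q> P \<xi> J \<kappa>" and Q: "Q \<in> \<Q>" and p: "p > 0" and n: "n > 0"
    and basis: "discrete_basis p \<phi> \<phi>\<^sub>s" and j: "j \<in> {1..p}"
  shows "xi_coef n p \<phi> (J Q) j \<in> borel_measurable (P Q)"
    and "integrable (P Q) (\<lambda>\<omega>. (xi_coef n p \<phi> (J Q) j \<omega>)\<^sup>2)"
    and "(\<integral>\<omega>. (xi_coef n p \<phi> (J Q) j \<omega>)\<^sup>2 \<partial>P Q) \<le> \<kappa> Q"
proof -
  let ?c = "\<lambda>k. \<phi> j (grid p k)"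
  let ?f = "step_fun p (n * p) ?c"
  have L2: "L2_on 0 (real n) ?f" by (rule L2_on_step_fun)
  have m: "J Q ?f \<in> borel_measurable (P Q)" and i: "integrable (P Q) (\<lambda>\<omega>. (J Q ?f \<omega>)\<^sup>2)"
    and b: "(\<integral>\<omega>. (J Q ?f \<omega>)\<^sup>2 \<partial>P Q)
      \<le> \<kappa> Q * set_lebesgue_integral lborel {0..real n} (\<lambda>s. (?f s)\<^sup>2)"
    using model Q L2 unfolding noise_model_def stochastic_integral_def by blast+
  have sq: "(xi_coef n p \<phi> (J Q) j \<omega>)\<^sup>2 = (J Q ?f \<omega>)\<^sup>2 / real n" for \<omega>
    by (simp add: xi_coef_def psi_eq_step_fun power_divide)
  show "xi_coef n p \<phi> (J Q) j \<in> borel_measurable (P Q)"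
    using m by (simp add: xi_coef_def[abs_def] psi_eq_step_fun)
  show "integrable (P Q) (\<lambda>\<omega>. (xi_coef n p \<phi> (J Q) j \<omega>)\<^sup>2)"
    using i by (simp add: sq)
  have "(\<Sum>k=1..n * p. (?c k)\<^sup>2) = real n * (\<Sum>k=1..p. (?c k)\<^sup>2)"
  proof (rule sum_periodic)
    show "(?c (l + p))\<^sup>2 = (?c l)\<^sup>2" for l
      using basis j by (simp add: grid_add_period[OF p] discrete_basis_def periodic1_def)
  qed
  moreover have "(\<Sum>k=1..p. (?c k)\<^sup>2) = real p"
  proof -
    have "1 / real p * (\<Sum>k=1..p. ?c k * ?c k) = 1"
      using basis j unfolding discrete_basis_def by auto
    then show ?thesis using p by (simp add: power2_eq_square field_simps)
  qed
  ultimately have "(\<integral>\<omega>. (J Q ?f \<omega>)\<^sup>2 \<partial>P Q) \<le> \<kappa> Q * real n"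
    using b p by (simp add: integral_step_fun_square[OF p])
  then show "(\<integral>\<omega>. (xi_coef n p \<phi> (J Q) j \<omega>)\<^sup>2 \<partial>P Q) \<le> \<kappa> Q"
    using n by (simp add: sq divide_le_eq)
qed

section \<open>Risk comparison\<close>

lemma norm_d_eq_L2_set: "norm_d d x = L2_set (\<lambda>i. x (Suc i)) {..<d}"
  by (simp add: norm_d_def L2_set_def sum.atLeast1_atMost_eq)

text \<open>Only the first \<open>d\<close> coordinates change, and there the weight is 1. With
  \<open>g = c / N\<close> each contributes
  \<open>g\<^sup>2 v\<^sup>2 - 2 g v (v - \<theta>)\<close>. The first terms add up to
  \<open>g\<^sup>2 N\<^sup>2\<close>, which is \<open>c\<^sup>2\<close> unless \<open>N = 0\<close>,
  when division by zero gives \<open>g = 0\<close>.\<close>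

lemma shrinkage_error_difference:
  fixes \<gamma> \<theta> v :: "nat \<Rightarrow> real" and c :: real
  assumes d: "d \<le> p" and \<gamma>: "\<And>j. j \<in> {1..d} \<Longrightarrow> \<gamma> j = 1"
  defines "N \<equiv> norm_d d v"
  defines "v' \<equiv> \<lambda>j. (1 - (if 1 \<le> j \<and> j \<le> d then c / N else 0)) * v j"
  shows "((\<Sum>j=1..p. (\<gamma> j * v' j)\<^sup>2) - 2 * (\<Sum>j=1..p. \<gamma> j * v' j * \<theta> j))
      - ((\<Sum>j=1..p. (\<gamma> j * v j)\<^sup>2) - 2 * (\<Sum>j=1..p. \<gamma> j * v j * \<theta> j))
    = (if N = 0 then 0 else c\<^sup>2) - 2 * c * ((\<Sum>j=1..d. v j * (v j - \<theta> j)) / N)" (is "?lhs = _")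
proof -
  let ?g = "c / N"
  have "?lhs = (\<Sum>j=1..p. (\<gamma> j * v' j)\<^sup>2 - 2 * (\<gamma> j * v' j * \<theta> j)
      - ((\<gamma> j * v j)\<^sup>2 - 2 * (\<gamma> j * v j * \<theta> j)))"
    by (simp add: sum_subtractf sum_distrib_left)
  also have "\<dots> = (\<Sum>j=1..d. (\<gamma> j * v' j)\<^sup>2 - 2 * (\<gamma> j * v' j * \<theta> j)
      - ((\<gamma> j * v j)\<^sup>2 - 2 * (\<gamma> j * v j * \<theta> j)))"
    using d by (intro sum.mono_neutral_right) (auto simp: v'_def)
  also have "\<dots> = (\<Sum>j=1..d. ?g\<^sup>2 * (v j)\<^sup>2 - 2 * ?g * (v j * (v j - \<theta> j)))"
    using \<gamma> by (intro sum.cong refl) (simp add: v'_def power2_eq_square algebra_simps)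
  also have "\<dots> = ?g\<^sup>2 * (\<Sum>j=1..d. (v j)\<^sup>2) - 2 * ?g * (\<Sum>j=1..d. v j * (v j - \<theta> j))"
    by (simp only: sum_subtractf sum_distrib_left)
  also have "(\<Sum>j=1..d. (v j)\<^sup>2) = N\<^sup>2"
    by (simp add: N_def norm_d_def sum_nonneg)
  finally show ?thesis
    by (simp add: power_divide)
qed

lemma lipschitz_signals_continuous: "S \<in> lipschitz_signals r \<Longrightarrow> continuous_on UNIV S"
  by (auto simp: lipschitz_signals_def intro: lipschitz_on_continuous_on)

text \<open>The loss difference is at most \<open>c\<^sup>2 - 2 c F\<close>, where \<open>F\<close>
  is the component of the noise along the vector of the first \<open>d\<close> coefficients. The
  mean of \<open>F\<close> is at least \<open>c\<close>, so the mean difference is at most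
  \<open>c\<^sup>2 - 2 c\<^sup>2\<close>. This \<open>c\<close> minimizes
  \<open>x\<^sup>2 - 2 x b\<close> for the lower bound \<open>b\<close> on the mean of
  \<open>F\<close>.\<close>

lemma risk_difference_le:
  fixes J :: "(real \<Rightarrow> real) measure \<Rightarrow> (real \<Rightarrow> real) \<Rightarrow> 'w \<Rightarrow> real"
  assumes model: "noise_model n \<Q> P \<xi> J \<kappa>" and Q: "Q \<in> \<Q>"
    and p: "p > 0" and n: "n > 0" and d: "d > 0" "d \<le> p"
    and basis: "discrete_basis p \<phi> \<phi>\<^sub>s"
    and \<gamma>: "\<And>j. j \<in> {1..d} \<Longrightarrow> \<gamma> j = 1"
    and \<kappa>s: "\<kappa> Q \<le> \<kappa>\<^sub>s" and r: "r > 0" and S: "S \<in> lipschitz_signals r"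
    and H2: "H2 n p d \<phi> \<Q> P J l"
    and c: "c = shrink_const n d l r \<kappa>\<^sub>s"
  shows "enn2ereal (quadratic_risk (P Q) (observation y0 \<xi> S) (S_star n p \<phi> d c \<gamma>) S)
       - enn2ereal (quadratic_risk (P Q) (observation y0 \<xi> S) (S_hat n p \<phi> \<gamma>) S) \<le> ereal (- (c\<^sup>2))"
proof -
  interpret prob_space "P Q"
    using model Q by (simp add: noise_model_def)
  have contS: "continuous_on UNIV S" and perS: "periodic1 S" and normS: "L2_norm_unit S \<le> r"
    using S lipschitz_signals_continuous by (auto simp: lipschitz_signals_def)
  from H2 obtain \<G> where l: "l > 0" and sub: "subalgebra (P Q) \<G>"
    and cg: "cond_gaussian (P Q) \<G> d (\<lambda>i. xi_coef n p \<phi> (J Q) (Suc i))"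
    and gap: "AE \<omega> in P Q. l \<le> mat_tr (cond_cov (P Q) \<G> d (\<lambda>i. xi_coef n p \<phi> (J Q) (Suc i)) \<omega>)
      - lambda_max (cond_cov (P Q) \<G> d (\<lambda>i. xi_coef n p \<phi> (J Q) (Suc i)) \<omega>)"
    using Q unfolding H2_def Let_def by blast
  have \<kappa>pos: "\<kappa>\<^sub>s > 0"
    using model Q \<kappa>s by (auto simp: noise_model_def intro: less_le_trans)
  define \<sigma> where "\<sigma> = 1 / sqrt (real n)"
  have \<sigma>: "\<sigma> > 0" "\<sigma>\<^sup>2 = 1 / real n"
    using n by (auto simp: \<sigma>_def power_divide)
  let ?\<xi> = "xi_coef n p \<phi> (J Q)" and ?\<theta> = "theta_bar p \<phi> S"
  \<comment> \<open>The coefficients expressed through the integral. They agree with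
    \<open>theta_hat\<close> almost surely, so all means are computed for \<open>v\<close> and
    transferred at the end.\<close>
  define v where "v \<omega> j = ?\<theta> j + \<sigma> * ?\<xi> j \<omega>" for \<omega> j
  note moment = xi_coef_second_moment[OF model Q p n basis]
  note [measurable] = moment(1)
  have int1: "integrable (P Q) (?\<xi> j)" if "j \<in> {1..p}" for j
    using square_integrable_imp_integrable[OF moment(1,2)] that by blast
  have int2: "integrable (P Q) (\<lambda>\<omega>. (v \<omega> j)\<^sup>2)" if "j \<in> {1..p}" for j
  proof -
    have "(v \<omega> j)\<^sup>2 = (?\<theta> j)\<^sup>2 + 2 * ?\<theta> j * \<sigma> * ?\<xi> j \<omega> + \<sigma>\<^sup>2 * (?\<xi> j \<omega>)\<^sup>2" for \<omega>
      by (simp add: v_def power2_eq_square algebra_simps)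
    then show ?thesis
      using int1[OF that] moment(2)[OF that] by simp
  qed
  have intv: "integrable (P Q) (\<lambda>\<omega>. v \<omega> j)" if "j \<in> {1..p}" for j
    using int1[OF that] by (simp add: v_def)
  define Err where "Err a = (\<Sum>j=1..p. (a j)\<^sup>2) - 2 * (\<Sum>j=1..p. a j * ?\<theta> j) + (L2_norm_unit S)\<^sup>2" for a
  have Err: "(L2_norm_unit (\<lambda>t. (\<Sum>j=1..p. a j * psi n p \<phi> j t) - S t))\<^sup>2 = Err a" for a
    unfolding Err_def by (rule L2_error_expansion[OF p n contS basis])
  have Err_nonneg: "Err a \<ge> 0" for a
    unfolding Err[symmetric] by simp
  define F where "F \<omega> = (\<Sum>j=1..d. v \<omega> j * (v \<omega> j - ?\<theta> j)) / norm_d d (v \<omega>)" for \<omega>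
  define v' where "v' \<omega> j = (1 - (if 1 \<le> j \<and> j \<le> d then c / norm_d d (v \<omega>) else 0)) * v \<omega> j" for \<omega> j
  define D where "D \<omega> = Err (\<lambda>j. \<gamma> j * v \<omega> j)" for \<omega>
  define D' where "D' \<omega> = Err (\<lambda>j. \<gamma> j * v' \<omega> j)" for \<omega>
  \<comment> \<open>On the event that the first \<open>d\<close> coefficients all vanish
    \<open>Z\<close> is 0; using only \<open>Z \<le> c\<^sup>2\<close> makes it unnecessary to show
    that this event is null.\<close>
  define Z where "Z \<omega> = (if norm_d d (v \<omega>) = 0 then 0 else c\<^sup>2)" for \<omega>
  have diff: "D' \<omega> = D \<omega> + (Z \<omega> - 2 * c * F \<omega>)" for \<omega>
    using shrinkage_error_difference[where \<gamma> = \<gamma> and v = "v \<omega>" and \<theta> = ?\<theta> and c = c, OF d(2) \<gamma>]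
    unfolding D_def D'_def Err_def F_def Z_def v'_def by linarith
  have F_eq: "F \<omega> = (\<Sum>i<d. (?\<theta> (Suc i) + \<sigma> * ?\<xi> (Suc i) \<omega>) * (\<sigma> * ?\<xi> (Suc i) \<omega>))
      / L2_set (\<lambda>i. ?\<theta> (Suc i) + \<sigma> * ?\<xi> (Suc i) \<omega>) {..<d}" for \<omega>
    by (simp add: F_def v_def norm_d_eq_L2_set sum.atLeast1_atMost_eq)
  have X: "?\<xi> (Suc i) \<in> borel_measurable (P Q)" "integrable (P Q) (\<lambda>\<omega>. (?\<xi> (Suc i) \<omega>)\<^sup>2)"
    "expectation (\<lambda>\<omega>. (?\<xi> (Suc i) \<omega>)\<^sup>2) \<le> \<kappa>\<^sub>s" if "i < d" for i
    using moment[of "Suc i"] that d \<kappa>s by auto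
  have bound: "integrable (P Q) F" "\<sigma>\<^sup>2 * l / (r + \<sigma> * sqrt (real d * \<kappa>\<^sub>s)) \<le> expectation F"
    unfolding F_eq[abs_def]
    using cond_gaussian_direction_bound[where X = "\<lambda>i. ?\<xi> (Suc i)" and a = "\<lambda>i. ?\<theta> (Suc i)" and \<sigma> = \<sigma>,
        OF prob_space_axioms d(1) sub cg gap less_imp_le[OF l] less_imp_le[OF \<sigma>(1)] \<kappa>pos r X
        order.trans[OF theta_bar_bessel[OF p contS basis d(2)] normS]]
    by blast+
  \<comment> \<open>Moving \<open>\<sigma>\<close> under the root shows that
    \<open>shrink_const\<close> is exactly the lower bound for the mean of \<open>F\<close>.\<close>
  have "\<sigma> * sqrt (real d * \<kappa>\<^sub>s) = sqrt (real d / real n * \<kappa>\<^sub>s)"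
    by (simp add: \<sigma>_def real_sqrt_mult real_sqrt_divide)
  then have c_eq: "c = \<sigma>\<^sup>2 * l / (r + \<sigma> * sqrt (real d * \<kappa>\<^sub>s))"
    by (simp add: c shrink_const_def \<sigma>(2))
  have c_nonneg: "c \<ge> 0"
    unfolding c_eq using l r \<sigma> \<kappa>pos by simp
  have [measurable]: "(\<lambda>\<omega>. norm_d d (v \<omega>)) \<in> borel_measurable (P Q)"
    unfolding norm_d_def v_def
    using d by (intro measurable_compose[OF _ borel_measurable_sqrt] borel_measurable_sum
      borel_measurable_power borel_measurable_add borel_measurable_times borel_measurable_const moment(1)) auto
  have intZ: "integrable (P Q) Z"
    by (rule integrable_const_bound[where B = "c\<^sup>2"]) (auto simp: Z_def[abs_def])
  have "expectation Z \<le> (\<integral>\<omega>. c\<^sup>2 \<partial>P Q)"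
    using intZ by (intro integral_mono) (auto simp: Z_def)
  then have EZ: "expectation Z \<le> c\<^sup>2"
    by (simp add: prob_space)
  have intD: "integrable (P Q) D"
    unfolding D_def Err_def power_mult_distrib using int2 intv
    by (intro Bochner_Integration.integrable_add Bochner_Integration.integrable_diff
        Bochner_Integration.integrable_sum integrable_mult_right integrable_mult_left integrable_const) auto
  have intD': "integrable (P Q) D'"
    unfolding diff[abs_def] using intD intZ bound(1) by simp
  have "expectation D' = expectation D + (expectation Z - 2 * c * expectation F)"
    unfolding diff[abs_def] using intD intZ bound(1) by simp
  moreover have "c * c \<le> c * expectation F"
    using bound(2) c_nonneg by (intro mult_left_mono) (simp_all add: c_eq)
  ultimately have main: "expectation D' - expectation D \<le> - (c\<^sup>2)"
    using EZ by (simp add: power2_eq_square)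
  have "AE \<omega> in P Q. \<forall>j\<in>{1..p}. theta_hat n p \<phi> (observation y0 \<xi> S \<omega>) j = v \<omega> j"
  proof (intro AE_finite_allI ballI)
    fix j assume "j \<in> {1..p}"
    then have "periodic1 (\<phi> j)" using basis by (auto simp: discrete_basis_def)
    then show "AE \<omega> in P Q. theta_hat n p \<phi> (observation y0 \<xi> S \<omega>) j = v \<omega> j"
      unfolding v_def \<sigma>_def
      using model Q by (intro theta_hat_eq_theta_bar_plus_noise p n contS perS) (auto simp: noise_model_def)
  qed simp
  then have "AE \<omega> in P Q.
      (L2_norm_unit (\<lambda>t. S_hat n p \<phi> \<gamma> (observation y0 \<xi> S \<omega>) t - S t))\<^sup>2 = D \<omega>
    \<and> (L2_norm_unit (\<lambda>t. S_star n p \<phi> d c \<gamma> (observation y0 \<xi> S \<omega>) t - S t))\<^sup>2 = D' \<omega>"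
  proof eventually_elim
    case (elim \<omega>)
    let ?h = "theta_hat n p \<phi> (observation y0 \<xi> S \<omega>)"
    have N: "norm_d d ?h = norm_d d (v \<omega>)"
      unfolding norm_d_def using elim d by simp
    have "S_hat n p \<phi> \<gamma> (observation y0 \<xi> S \<omega>) t = (\<Sum>j=1..p. \<gamma> j * v \<omega> j * psi n p \<phi> j t)" for t
      unfolding S_hat_def using elim by (intro sum.cong refl) auto
    moreover have "S_star n p \<phi> d c \<gamma> (observation y0 \<xi> S \<omega>) t
        = (\<Sum>j=1..p. \<gamma> j * v' \<omega> j * psi n p \<phi> j t)" for t
      unfolding S_star_def theta_star_def shrink_factor_def v'_def N
      using elim by (intro sum.cong refl) auto
    ultimately show ?case
      unfolding D_def D'_def Err[symmetric] by (simp only:)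
  qed
  then have hat: "quadratic_risk (P Q) (observation y0 \<xi> S) (S_hat n p \<phi> \<gamma>) S = (\<integral>\<^sup>+\<omega>. ennreal (D \<omega>) \<partial>P Q)"
    and star: "quadratic_risk (P Q) (observation y0 \<xi> S) (S_star n p \<phi> d c \<gamma>) S = (\<integral>\<^sup>+\<omega>. ennreal (D' \<omega>) \<partial>P Q)"
    unfolding quadratic_risk_def by (auto intro!: nn_integral_cong_AE)
  have nonneg: "0 \<le> D \<omega>" "0 \<le> D' \<omega>" for \<omega>
    by (simp_all add: D_def D'_def Err_nonneg)
  \<comment> \<open>Both losses are integrable, so both risks are finite and the difference of
    extended reals is one of real numbers.\<close>
  have "enn2ereal (\<integral>\<^sup>+\<omega>. ennreal (D' \<omega>) \<partial>P Q) - enn2ereal (\<integral>\<^sup>+\<omega>. ennreal (D \<omega>) \<partial>P Q)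
      = ereal (expectation D') - ereal (expectation D)"
    using intD intD' nonneg by (simp add: nn_integral_eq_integral enn2ereal_ennreal)
  then show ?thesis
    unfolding hat star using main by simp
qed

theorem theorem4p1:
  fixes \<Q> :: "nat \<Rightarrow> (real \<Rightarrow> real) measure set"
    and P :: "nat \<Rightarrow> (real \<Rightarrow> real) measure \<Rightarrow> 'w measure"
    and \<xi> :: "nat \<Rightarrow> real \<Rightarrow> 'w \<Rightarrow> real"
    and J :: "nat \<Rightarrow> (real \<Rightarrow> real) measure \<Rightarrow> (real \<Rightarrow> real) \<Rightarrow> 'w \<Rightarrow> real"
    and \<kappa> :: "nat \<Rightarrow> (real \<Rightarrow> real) measure \<Rightarrow> real"
    and y0 :: "'w \<Rightarrow> real"
    and p :: "nat \<Rightarrow> nat"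
    and \<Gamma> :: "nat \<Rightarrow> (nat \<Rightarrow> real) set"
    and dg :: "nat \<Rightarrow> (nat \<Rightarrow> real) \<Rightarrow> nat"
    and r :: "nat \<Rightarrow> real"
    and \<phi> :: "nat \<Rightarrow> real \<Rightarrow> real"
    and \<phi>\<^sub>s l\<^sub>s c :: real
    and n d :: nat
    and \<gamma> :: "nat \<Rightarrow> real"
  assumes model: "\<And>m. m \<ge> 1 \<Longrightarrow> noise_model m (\<Q> m) (P m) (\<xi> m) (J m) (\<kappa> m)"
    and weights: "weight_sets p \<Gamma>"
    and radius: "\<And>m. m \<ge> 1 \<Longrightarrow> 0 < r m" "subpolynomial r"
    and n: "n \<ge> 3" and p: "p n \<ge> 1" and d: "d \<ge> 2"
    and basis: "discrete_basis (p n) \<phi> \<phi>\<^sub>s"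
    and gamma: "\<gamma> \<in> \<Gamma> n" "d = dg n \<gamma>" "d \<le> p n"
    and H1: "H1 \<Q> \<kappa>"
    and H2: "H2 n (p n) d \<phi> (\<Q> n) (P n) (J n) l\<^sub>s"
    and H3: "H3 p \<Gamma> dg"
    and c: "c = shrink_const n d l\<^sub>s (r n) (kappa_star \<Q> \<kappa> n)"
  shows "(SUP Q\<in>\<Q> n. SUP S\<in>lipschitz_signals (r n).
            enn2ereal (quadratic_risk (P n Q) (observation y0 (\<xi> n) S) (S_star n (p n) \<phi> d c \<gamma>) S)
          - enn2ereal (quadratic_risk (P n Q) (observation y0 (\<xi> n) S) (S_hat n (p n) \<phi> \<gamma>) S))
         \<le> ereal (- (c\<^sup>2))"
\<comment> \<open>The constant \<open>c\<close> involves neither \<open>Q\<close> nor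
  \<open>S\<close>, so it is enough to bound the difference for each pair.\<close>
proof (intro SUP_least)
  fix Q S assume Q: "Q \<in> \<Q> n" and S: "S \<in> lipschitz_signals (r n)"
  have n1: "n \<ge> 1" using n by simp
  have "\<gamma> j = 1" if "j \<in> {1..d}" for j
    using H3 gamma that n1 unfolding H3_def by blast
  \<comment> \<open>\<open>kappa_star\<close> is a supremum of reals; the boundedness in
    \<open>H1\<close> is what makes it an upper bound.\<close>
  moreover have "\<kappa> n Q \<le> kappa_star \<Q> \<kappa> n"
    unfolding kappa_star_def using H1 n1 Q by (intro cSUP_upper) (auto simp: H1_def)
  ultimately show "enn2ereal (quadratic_risk (P n Q) (observation y0 (\<xi> n) S) (S_star n (p n) \<phi> d c \<gamma>) S)
      - enn2ereal (quadratic_risk (P n Q) (observation y0 (\<xi> n) S) (S_hat n (p n) \<phi> \<gamma>) S) \<le> ereal (- (c\<^sup>2))"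
    using n p d gamma(3) radius(1)[OF n1]
    by (intro risk_difference_le[OF model[OF n1] Q _ _ _ _ basis _ _ _ S H2 c]) auto
qed

end
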